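(* Let $\zeta\in(-1/2,\infty)$. Then there exist constants $c_1,\dots,c_8\in(0,\infty)$, depending only on $\zeta$, such that for all $r,s,t>0$, \[ c_1\, t^{-1/2}\frac{\exp\!\big(-\tfrac{(r-s)^2}{c_2 t}\big)}{(rs+t)^{\zeta}}\le p_\zeta^{(2)}(t,r,s)\le c_3\, t^{-1/2}\frac{\exp\!\big(-\tfrac{(r-s)^2}{c_4 t}\big)}{(rs+t)^{\zeta}}, \] and \[ c_5\, A_\zeta(t,r,s)\exp\!\Big(-\tfrac{(r-s)^2}{c_6 t}\Big)\le p_\zeta^{(2)}(t,r,s)\le c_7\, A_\zeta(t,r,s)\exp\!\Big(-\tfrac{(r-s)^2}{c_8 t}\Big), \] where $A_\zeta(t,r,s):=\big(1\wedge \tfrac{r}{t^{1/2}}\big)^{\zeta}\big(1\wedge \tfrac{s}{t^{1/2}}\big)^{\zeta}\big(\tfrac{1}{rs}\big)^{\zeta} t^{-1/2}$. Moreover, for every $\alpha\in(0,2)$ there is a constant $K\ge1$, depending only on $\zeta$ and $\alpha$, such that for all $r,s,t>0$, \[ K^{-1} Q\le p_\zeta^{(\alpha)}(t,r,s)\le K Q,\qquad Q:=\frac{t}{|r-s|^{1+\alpha}(r+s)^{2\zeta}+t^{\frac{1+\alpha}{\alpha}}\big(t^{\frac1\alpha}+r+s\big)^{2\zeta}}. \]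
   Context: For $z\in\mathbb{C}\setminus(-\infty,0]$ and $\nu\in\mathbb{C}$, $I_\nu$ denotes the modified Bessel function of the first kind of order $\nu$. For $\zeta\in(-1/2,\infty)$ the Bessel heat kernel is \[ p_\zeta^{(2)}(t,r,s):=\frac{(rs)^{1/2-\zeta}}{2t}\exp\Big(-\frac{r^2+s^2}{4t}\Big)I_{\zeta-1/2}\Big(\frac{rs}{2t}\Big),\quad r,s,t>0. \] For $\alpha\in(0,2)$ and $t>0$, let $\sigma_t^{(\alpha/2)}$ be the probability density on $(0,\infty)$ of the $\alpha/2$-stable subordinator, i.e. $e^{-t\lambda^{\alpha/2}}=\int_0^\infty e^{-\tau\lambda}\sigma_t^{(\alpha/2)}(\tau)\,d\tau$ for all $\lambda\ge0$. The subordinated Bessel heat kernel is $p_\zeta^{(\alpha)}(t,r,s):=\int_0^\infty p_\zeta^{(2)}(\tau,r,s)\,\sigma_t^{(\alpha/2)}(\tau)\,d\tau$ for $r,s,t>0$. Notation: $a\wedge b=\min\{a,b\}$. *)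

theory Defs
  imports "HOL-Analysis.Analysis"
begin

text \<open>Modified Bessel function of the first kind, for real argument x > 0 and real order nu,
  via its defining power series (valid whenever nu is not a negative integer; here nu > -1).\<close>
definition bessel_I :: "real \<Rightarrow> real \<Rightarrow> real" where
  "bessel_I nu x = (\<Sum>k. (x / 2) powr (2 * real k + nu) / (fact k * Gamma (real k + nu + 1)))"

definition bessel_heat :: "real \<Rightarrow> real \<Rightarrow> real \<Rightarrow> real \<Rightarrow> real" where
  "bessel_heat \<zeta> t r s =
     (r * s) powr (1/2 - \<zeta>) / (2 * t) * exp (- (r\<^sup>2 + s\<^sup>2) / (4 * t))
     * bessel_I (\<zeta> - 1/2) (r * s / (2 * t))"

definition stable_subordinator_density :: "real \<Rightarrow> (real \<Rightarrow> real \<Rightarrow> real) \<Rightarrow> bool" where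
  "stable_subordinator_density \<alpha> \<sigma> \<longleftrightarrow>
     (\<forall>t>0. (\<forall>\<tau>>0. \<sigma> t \<tau> \<ge> 0) \<and>
        (\<forall>l\<ge>0. ((\<lambda>\<tau>. exp (- \<tau> * l) * \<sigma> t \<tau>) has_integral exp (- t * l powr (\<alpha> / 2))) {0<..}))"

definition sub_bessel_heat :: "(real \<Rightarrow> real \<Rightarrow> real) \<Rightarrow> real \<Rightarrow> real \<Rightarrow> real \<Rightarrow> real \<Rightarrow> real" where
  "sub_bessel_heat \<sigma> \<zeta> t r s = integral {0<..} (\<lambda>\<tau>. bessel_heat \<zeta> \<tau> r s * \<sigma> t \<tau>)"

definition A_zeta :: "real \<Rightarrow> real \<Rightarrow> real \<Rightarrow> real \<Rightarrow> real" where
  "A_zeta \<zeta> t r s = (min 1 (r / sqrt t)) powr \<zeta> * (min 1 (s / sqrt t)) powr \<zeta>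
     * (1 / (r * s)) powr \<zeta> * t powr (-1/2)"

definition Q_bound :: "real \<Rightarrow> real \<Rightarrow> real \<Rightarrow> real \<Rightarrow> real \<Rightarrow> real" where
  "Q_bound \<zeta> \<alpha> t r s = t / (\<bar>r - s\<bar> powr (1 + \<alpha>) * (r + s) powr (2 * \<zeta>)
     + t powr ((1 + \<alpha>) / \<alpha>) * (t powr (1 / \<alpha>) + r + s) powr (2 * \<zeta>))"

end

theory Submission
  imports Defs "HOL-Real_Asymp.Real_Asymp"
begin

text \<open>
  By the duplication formula, the power series of the Bessel function of order \<open>\<zeta> - 1/2\<close> has, up to the
  factor \<open>(z / 2) powr (\<zeta> - 1/2)\<close>, coefficients comparable to \<open>(2 k + 1) powr (- \<zeta>) / (2 k)!\<close>. It is thus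
  a power moment of a Poisson variable restricted to even values, and these moments behave like
  \<open>exp z * (1 + z) powr (- \<zeta>)\<close>. This gives the Gaussian bounds with \<open>c\<^sub>2 = c\<^sub>4 = 4\<close>; replacing
  \<open>r s + t\<close> by \<open>max r (sqrt t) * max s (sqrt t)\<close> costs a power of \<open>1 + \<bar>r - s\<bar> / sqrt t\<close>, which a part of
  the Gaussian absorbs.

  For the subordinated kernel no pointwise bounds on the stable density are needed: with
  \<open>D = max \<bar>r - s\<bar> (t powr (1 / \<alpha>))\<close>, the heat kernel at time \<open>\<tau>\<close> is bounded above and below, as a function
  of \<open>u = \<tau> / D\<^sup>2\<close>, by combinations of exponentials \<open>exp (- l u)\<close>, whose integrals are given by the
  Laplace transform.
\<close>

section \<open>Power moments of the Poisson distribution\<close>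

text \<open>Put \<open>u = \<tau> / D\<^sup>2\<close> and
  \<open>\<epsilon> = t * D powr (- \<alpha>)\<close>. The choice of \<open>D\<close> gives
  \<open>\<epsilon> \<le> 1\<close>, with equality if \<open>D = t powr (1 / \<alpha>)\<close>. For
  the lower bound it is enough that \<open>u\<close> lies in a fixed window with probability at
  least \<open>\<epsilon> / 4\<close>; \<open>\<alpha> < 2\<close> makes such a window available.
  The obstacle to the upper bound is small \<open>u\<close>, where the profile may grow like
  \<open>u powr (- (1/2 + \<bar>\<zeta>\<bar>))\<close>. If \<open>D = \<bar>r - s\<bar>\<close>,
  the Gaussian is \<open>exp (- 1 / (4 * u))\<close> and beats every power, leaving a multiple of
  \<open>1 - exp (- u)\<close>, whose integral is at most \<open>\<epsilon>\<close>. If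
  \<open>D = t powr (1 / \<alpha>)\<close>, the Gaussian gives no help, but then
  \<open>\<epsilon> = 1\<close> and a bounded negative moment is all that is required. The condition
  \<open>\<zeta> > -1/2\<close> makes the Gamma factors of the series positive and keeps
  \<open>u powr (- 1/2 - \<zeta>)\<close> bounded for large \<open>u\<close>. As
  \<open>\<zeta>\<close> may have either sign, bases of powers are compared from both sides, at the
  price of a factor \<open>k powr \<bar>\<zeta>\<bar>\<close>.\<close>

lemma powr_le_const_mult_powr:
  fixes x y k q :: real
  assumes "0 < x" "0 < y" "1 \<le> k" "x \<le> k * y" "y \<le> k * x"
  shows "x powr q \<le> k powr \<bar>q\<bar> * y powr q"
proof (cases "q \<ge> 0")
  case True
  have "x powr q \<le> (k * y) powr q" using assms True by (intro powr_mono2) auto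
  then show ?thesis using True assms by (simp add: powr_mult)
next
  case False
  have "(k * x) powr q \<le> y powr q" using assms False by (intro powr_mono2') auto
  then have "k powr q * x powr q \<le> y powr q" using assms by (simp add: powr_mult)
  then have "k powr (-q) * (k powr q * x powr q) \<le> k powr (-q) * y powr q"
    by (intro mult_left_mono) auto
  moreover have "k powr (-q) * (k powr q * x powr q) = x powr q"
    using assms by (simp add: powr_minus field_simps)
  ultimately show ?thesis using False by simp
qed

text \<open>Whichever side of 1 the base lies on, one of the two extreme powers dominates. This
  interpolates a real exponent between the integers \<open>m\<close> and \<open>-m\<close>.\<close>

lemma powr_le_sum_powr:
  fixes x q m :: real
  assumes "0 < x" "\<bar>q\<bar> \<le> m"
  shows "x powr q \<le> x powr m + x powr (-m)"
proof (cases "x \<ge> 1")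
  case True
  then have "x powr q \<le> x powr m" using assms by (intro powr_mono) auto
  then show ?thesis by (simp add: add_increasing2)
next
  case False
  then have "x powr q \<le> x powr (-m)" using assms by (intro powr_mono') auto
  then show ?thesis by (simp add: add_increasing)
qed

lemma pos_limit_imp_bounds:
  fixes f :: "nat \<Rightarrow> real"
  assumes "f \<longlonglongrightarrow> L" "L > 0" "\<And>n. f n > 0"
  obtains c C where "c > 0" "C > 0" "\<And>n. c \<le> f n" "\<And>n. f n \<le> C"
proof -
  have "Bseq f" using assms(1) by (intro convergent_imp_Bseq convergentI)
  then obtain C where C: "C > 0" "\<And>n. norm (f n) \<le> C" by (auto simp: Bseq_def)
  have "(\<lambda>n. inverse (f n)) \<longlonglongrightarrow> inverse L" using assms by (intro tendsto_inverse) auto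
  then have "Bseq (\<lambda>n. inverse (f n))" by (intro convergent_imp_Bseq convergentI)
  then obtain c where c: "c > 0" "\<And>n. norm (inverse (f n)) \<le> c" by (auto simp: Bseq_def)
  have "inverse c \<le> f n" for n
    using c(2)[of n] c(1) assms(3)[of n] by (simp add: field_simps)
  moreover have "f n \<le> C" for n using C(2)[of n] by simp
  ultimately show ?thesis using that[of "inverse c" C] c C by simp
qed

text \<open>This is \<open>exp z\<close> times the mean of \<open>(N + 1) powr q\<close> for a
  Poisson variable \<open>N\<close> with mean \<open>z\<close>. The shift by 1 keeps the base
  positive at \<open>n = 0\<close>, where \<open>0 powr q = 0\<close> would spoil negative
  exponents.\<close>

definition poisson_sum :: "real \<Rightarrow> real \<Rightarrow> real" where
  "poisson_sum q z = (\<Sum>n. z ^ n / fact n * (real n + 1) powr q)"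

text \<open>A power of \<open>n + 1\<close> is at most a constant times \<open>2 ^ n\<close>, so the
  exponential series at \<open>2 * z\<close> dominates.\<close>

lemma summable_poisson:
  assumes "z > 0"
  shows "summable (\<lambda>n. z ^ n / fact n * (real n + 1) powr q)"
proof -
  have "(\<lambda>n. (real n + 1) powr q / 2 ^ n) \<longlonglongrightarrow> 0" by real_asymp
  then have "Bseq (\<lambda>n. (real n + 1) powr q / 2 ^ n)" by (intro convergent_imp_Bseq convergentI)
  then obtain C where C: "\<And>n. norm ((real n + 1) powr q / 2 ^ n) \<le> C" by (auto simp: Bseq_def)
  have "summable (\<lambda>n. C * (inverse (fact n) * (2 * z) ^ n))"
    by (intro summable_mult summable_exp)
  then show ?thesis
  proof (rule summable_comparison_test'[where N = 0])
    fix n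
    have "(real n + 1) powr q \<le> C * 2 ^ n" using C[of n] by (simp add: field_simps)
    then have "z ^ n / fact n * (real n + 1) powr q \<le> z ^ n / fact n * (C * 2 ^ n)"
      using assms by (intro mult_left_mono) auto
    then show "norm (z ^ n / fact n * (real n + 1) powr q) \<le> C * (inverse (fact n) * (2 * z) ^ n)"
      using assms by (simp add: field_simps)
  qed
qed

lemma poisson_sum_nonneg: "z > 0 \<Longrightarrow> 0 \<le> poisson_sum q z"
  unfolding poisson_sum_def by (intro suminf_nonneg summable_poisson) auto

lemma poisson_sum_0: "poisson_sum 0 z = exp z"
  by (simp add: poisson_sum_def exp_def divide_inverse scaleR_conv_of_real mult.commute)

text \<open>Since \<open>n * z ^ n / fact n\<close> is \<open>z\<close> times the preceding weight,
  splitting one factor \<open>n + 1\<close> into \<open>1\<close> and \<open>n\<close> expresses the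
  moment of order \<open>q + 1\<close> by that of order \<open>q\<close> and a shifted sum
  \<open>R\<close>. Passing from \<open>n + 1\<close> to \<open>n + 2\<close> inside the power costs
  at most \<open>2 powr \<bar>q\<bar>\<close>.\<close>

lemma poisson_sum_Suc_bounds:
  assumes z: "z > 0"
  shows "poisson_sum (q + 1) z \<le> 2 powr \<bar>q\<bar> * (1 + z) * poisson_sum q z"
    and "(1 + z) * poisson_sum q z \<le> 2 powr \<bar>q\<bar> * poisson_sum (q + 1) z"
proof -
  define w where "w n = z ^ n / fact n" for n
  define R where "R = (\<Sum>n. w n * (real n + 2) powr q)"
  have w0: "w n \<ge> 0" for n using z by (simp add: w_def)
  have sq: "summable (\<lambda>n. w n * (real n + 1) powr q)" for q
    unfolding w_def by (rule summable_poisson[OF z])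
  have P: "poisson_sum q z = (\<Sum>n. w n * (real n + 1) powr q)" for q
    by (simp add: poisson_sum_def w_def)
  let ?k = "2 powr \<bar>q\<bar>"
  have k1: "1 \<le> ?k" by (simp add: ge_one_powr_ge_zero)
  have cmp1: "(real n + 2) powr q \<le> ?k * (real n + 1) powr q" for n
    by (rule powr_le_const_mult_powr) auto
  have cmp2: "(real n + 1) powr q \<le> ?k * (real n + 2) powr q" for n
    by (rule powr_le_const_mult_powr) auto
  have sR: "summable (\<lambda>n. w n * (real n + 2) powr q)"
  proof (rule summable_comparison_test'[where N = 0, OF summable_mult[OF sq, of ?k]])
    fix n
    show "norm (w n * (real n + 2) powr q) \<le> ?k * (w n * (real n + 1) powr q)"
      using mult_left_mono[OF cmp1 w0] w0 by (simp add: mult_ac)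
  qed
  have s2: "summable (\<lambda>n. w n * real n * (real n + 1) powr q)"
  proof (rule summable_comparison_test'[where N = 0, OF sq[of "q+1"]])
    fix n
    show "norm (w n * real n * (real n + 1) powr q) \<le> w n * (real n + 1) powr (q + 1)"
      using w0[of n] by (simp add: powr_add mult_left_mono algebra_simps)
  qed
  have "poisson_sum (q + 1) z = (\<Sum>n. w n * (real n + 1) powr q + w n * real n * (real n + 1) powr q)"
    unfolding P by (intro suminf_cong) (simp add: powr_add algebra_simps)
  also have "\<dots> = poisson_sum q z + (\<Sum>n. w n * real n * (real n + 1) powr q)"
    unfolding P by (rule suminf_add[symmetric, OF sq s2])
  \<comment> \<open>The factor \<open>real n\<close> kills the head term, so the index shifts
    without a remainder.\<close>
  also have "(\<Sum>n. w n * real n * (real n + 1) powr q)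
      = (\<Sum>n. w (Suc n) * real (Suc n) * (real (Suc n) + 1) powr q)"
    using suminf_split_head[OF s2] by simp
  also have "\<dots> = (\<Sum>n. z * (w n * (real n + 2) powr q))"
  proof (intro suminf_cong)
    fix n
    have "w (Suc n) * real (Suc n) = z * w n"
      by (simp add: w_def fact_Suc del: of_nat_Suc)
    then show "w (Suc n) * real (Suc n) * (real (Suc n) + 1) powr q = z * (w n * (real n + 2) powr q)"
      by (simp add: add.commute)
  qed
  also have "\<dots> = z * R" unfolding R_def using sR by (rule suminf_mult)
  finally have eq: "poisson_sum (q + 1) z = poisson_sum q z + z * R" .
  have "R \<le> (\<Sum>n. ?k * (w n * (real n + 1) powr q))"
    unfolding R_def
    by (intro suminf_le sR summable_mult sq) (use mult_left_mono[OF cmp1 w0] in \<open>simp add: mult_ac\<close>)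
  also have "\<dots> = ?k * poisson_sum q z" unfolding P using sq by (rule suminf_mult)
  finally have R1: "R \<le> ?k * poisson_sum q z" .
  have "poisson_sum q z \<le> (\<Sum>n. ?k * (w n * (real n + 2) powr q))"
    unfolding P
    by (intro suminf_le sR summable_mult sq) (use mult_left_mono[OF cmp2 w0] in \<open>simp add: mult_ac\<close>)
  also have "\<dots> = ?k * R" unfolding R_def using sR by (rule suminf_mult)
  finally have R2: "poisson_sum q z \<le> ?k * R" .
  have P0: "0 \<le> poisson_sum q z" by (rule poisson_sum_nonneg[OF z])
  have kP: "poisson_sum q z \<le> ?k * poisson_sum q z" using mult_right_mono[OF k1 P0] by simp
  have "poisson_sum (q + 1) z \<le> ?k * poisson_sum q z + z * (?k * poisson_sum q z)"
    unfolding eq using z by (intro add_mono kP mult_left_mono R1) auto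
  then show "poisson_sum (q + 1) z \<le> ?k * (1 + z) * poisson_sum q z"
    by (simp add: algebra_simps)
  have "(1 + z) * poisson_sum q z \<le> ?k * poisson_sum q z + z * (?k * R)"
    unfolding distrib_right mult_1_left using z by (intro add_mono kP mult_left_mono R2) auto
  then show "(1 + z) * poisson_sum q z \<le> ?k * poisson_sum (q + 1) z"
    unfolding eq by (simp add: algebra_simps)
qed

lemma poisson_sum_nat_le:
  "\<exists>C>0. \<forall>z>0. poisson_sum (real m) z \<le> C * exp z * (1 + z) powr real m"
proof (induction m)
  case 0
  then show ?case by (intro exI[of _ 1]) (simp add: poisson_sum_0)
next
  case (Suc m)
  then obtain C where C: "C > 0" "\<And>z. z > 0 \<Longrightarrow> poisson_sum (real m) z \<le> C * exp z * (1 + z) powr real m"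
    by blast
  have "poisson_sum (real (Suc m)) z \<le> (2 powr real m * C) * exp z * (1 + z) powr real (Suc m)"
    if z: "z > 0" for z
  proof -
    have "poisson_sum (real m + 1) z \<le> 2 powr \<bar>real m\<bar> * (1 + z) * poisson_sum (real m) z"
      by (rule poisson_sum_Suc_bounds[OF z])
    also have "\<dots> \<le> 2 powr \<bar>real m\<bar> * (1 + z) * (C * exp z * (1 + z) powr real m)"
      using z C by (intro mult_left_mono) auto
    finally show ?thesis using z by (simp add: powr_add algebra_simps)
  qed
  then show ?case using C by (intro exI[of _ "2 powr real m * C"]) auto
qed

text \<open>The second half of the recursion, taken at exponent \<open>- (m + 1)\<close>, steps
  downwards; its constant \<open>2 powr (m + 1)\<close> does not depend on \<open>z\<close>.\<close>

lemma poisson_sum_neg_nat_le: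
  "\<exists>C>0. \<forall>z>0. poisson_sum (- real m) z \<le> C * exp z * (1 + z) powr (- real m)"
proof (induction m)
  case 0
  then show ?case by (intro exI[of _ 1]) (simp add: poisson_sum_0)
next
  case (Suc m)
  then obtain C where C: "C > 0" "\<And>z. z > 0 \<Longrightarrow> poisson_sum (- real m) z \<le> C * exp z * (1 + z) powr (- real m)"
    by blast
  define k where "k = (2::real) powr real (Suc m)"
  have "poisson_sum (- real (Suc m)) z \<le> (k * C) * exp z * (1 + z) powr (- real (Suc m))"
    if z: "z > 0" for z
  proof -
    have "(1 + z) * poisson_sum (- real (Suc m)) z \<le> k * poisson_sum (- real m) z"
      using poisson_sum_Suc_bounds(2)[OF z, of "- real (Suc m)"] by (simp add: k_def add.commute)
    also have "\<dots> \<le> k * (C * exp z * (1 + z) powr (- real m))"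
      using z C by (intro mult_left_mono) (auto simp: k_def)
    also have "(1 + z) powr (- real m) = (1 + z) * (1 + z) powr (- real (Suc m))"
      using z powr_add[of "1 + z" 1 "- real (Suc m)"] by simp
    finally have "(1 + z) * poisson_sum (- real (Suc m)) z
        \<le> (1 + z) * ((k * C) * exp z * (1 + z) powr (- real (Suc m)))" by (simp add: mult_ac)
    then show ?thesis using z by (simp only: mult_le_cancel_left_pos)
  qed
  then show ?case using C by (intro exI[of _ "k * C"]) (auto simp: k_def)
qed

text \<open>Measure \<open>n + 1\<close> against its typical size \<open>y = 1 + z\<close>: the
  \<open>q\<close>-th power of the quotient is at most the sum of its powers with exponents
  \<open>m\<close> and \<open>-m\<close>, and for these the integer cases show that the mean is
  bounded.\<close>

lemma poisson_sum_le:
  "\<exists>C>0. \<forall>z>0. poisson_sum q z \<le> C * exp z * (1 + z) powr q"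
proof -
  obtain m :: nat where m: "\<bar>q\<bar> \<le> real m" using real_arch_simple by blast
  obtain C1 where C1: "C1 > 0" "\<And>z. z > 0 \<Longrightarrow> poisson_sum (real m) z \<le> C1 * exp z * (1 + z) powr real m"
    using poisson_sum_nat_le by blast
  obtain C2 where C2: "C2 > 0" "\<And>z. z > 0 \<Longrightarrow> poisson_sum (- real m) z \<le> C2 * exp z * (1 + z) powr (- real m)"
    using poisson_sum_neg_nat_le by blast
  have "poisson_sum q z \<le> (C1 + C2) * exp z * (1 + z) powr q" if z: "z > 0" for z
  proof -
    define y where "y = 1 + z"
    have y: "y > 0" using z by (simp add: y_def)
    define w where "w n = z ^ n / fact n" for n
    have w0: "w n \<ge> 0" for n using z by (simp add: w_def)
    have sq: "summable (\<lambda>n. w n * (real n + 1) powr q)" for q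
      unfolding w_def by (rule summable_poisson[OF z])
    have P: "poisson_sum q z = (\<Sum>n. w n * (real n + 1) powr q)" for q
      by (simp add: poisson_sum_def w_def)
    let ?a = "y powr (q - real m)" and ?b = "y powr (q + real m)"
    have termwise: "w n * (real n + 1) powr q
      \<le> ?a * (w n * (real n + 1) powr real m) + ?b * (w n * (real n + 1) powr (- real m))" for n
    proof -
      have "((real n + 1) / y) powr q \<le> ((real n + 1) / y) powr real m + ((real n + 1) / y) powr (- real m)"
        using y m by (intro powr_le_sum_powr) auto
      then have "(real n + 1) powr q / y powr q
          \<le> (real n + 1) powr real m / y powr real m + (real n + 1) powr (- real m) / y powr (- real m)"
        using y by (simp only: powr_divide)
      then have "y powr q * ((real n + 1) powr q / y powr q)
          \<le> y powr q * ((real n + 1) powr real m / y powr real m + (real n + 1) powr (- real m) / y powr (- real m))"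
        by (intro mult_left_mono) auto
      then have "(real n + 1) powr q \<le> ?a * (real n + 1) powr real m + ?b * (real n + 1) powr (- real m)"
        using y by (simp add: powr_diff powr_add powr_minus field_simps)
      from mult_left_mono[OF this w0] show ?thesis by (simp add: algebra_simps)
    qed
    have "poisson_sum q z
      \<le> (\<Sum>n. ?a * (w n * (real n + 1) powr real m) + ?b * (w n * (real n + 1) powr (- real m)))"
      unfolding P by (intro suminf_le termwise sq summable_add summable_mult)
    also have "\<dots> = ?a * poisson_sum (real m) z + ?b * poisson_sum (- real m) z"
      unfolding P by (simp only: suminf_add[symmetric] suminf_mult sq summable_mult)
    also have "\<dots> \<le> ?a * (C1 * exp z * y powr real m) + ?b * (C2 * exp z * y powr (- real m))"
      unfolding y_def by (intro add_mono mult_left_mono C1 C2 z) auto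
    also have "\<dots> = (C1 + C2) * exp z * y powr q"
      using y by (simp add: powr_diff powr_add powr_minus field_simps)
    finally show ?thesis by (simp add: y_def)
  qed
  then show ?thesis using C1 C2 by (intro exI[of _ "C1 + C2"]) auto
qed

text \<open>For the lower bound, \<open>2 \<le> \<mu> x + 1 / (\<mu> x)\<close> with \<open>x = ((n + 1) / (1 + z)) powr q\<close> reduces
  the claim to the upper bound for \<open>- q\<close>.\<close>

lemma even_poisson_sum_bounds:
  obtains c C where "c > 0" "C > 0"
    "\<And>z. z > 0 \<Longrightarrow> summable (\<lambda>k. z ^ (2 * k) / fact (2 * k) * (real (2 * k) + 1) powr q)"
    "\<And>z. z > 0 \<Longrightarrow> c * exp z * (1 + z) powr q
        \<le> (\<Sum>k. z ^ (2 * k) / fact (2 * k) * (real (2 * k) + 1) powr q)"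
    "\<And>z. z > 0 \<Longrightarrow> (\<Sum>k. z ^ (2 * k) / fact (2 * k) * (real (2 * k) + 1) powr q)
        \<le> C * exp z * (1 + z) powr q"
proof -
  obtain C where C: "C > 0" "\<And>z. z > 0 \<Longrightarrow> poisson_sum q z \<le> C * exp z * (1 + z) powr q"
    using poisson_sum_le by blast
  obtain C' where C': "C' > 0" "\<And>z. z > 0 \<Longrightarrow> poisson_sum (- q) z \<le> C' * exp z * (1 + z) powr (- q)"
    using poisson_sum_le by blast
  have sm: "strict_mono ((*) (2::nat))" by (auto simp: strict_mono_def)
  define e where "e q z k = z ^ (2 * k) / fact (2 * k) * (real (2 * k) + 1) powr q" for q z :: real and k :: nat
  have sume: "summable (e q z)" and lee: "suminf (e q z) \<le> poisson_sum q z" if z: "z > 0" for q z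
  proof -
    let ?f = "\<lambda>n. z ^ n / fact n * (real n + 1) powr q"
    let ?g = "\<lambda>n. if even n then ?f n else 0"
    have sg: "summable ?g"
      by (rule summable_comparison_test'[where N = 0, OF summable_poisson[OF z, of q]]) (use z in auto)
    have eq: "e q z = ?g \<circ> (*) 2" by (simp add: e_def fun_eq_iff)
    have z0: "n \<notin> range ((*) 2) \<Longrightarrow> ?g n = 0" for n by auto
    show "summable (e q z)" unfolding eq o_def
      using sg by (subst summable_mono_reindex[OF sm z0]) auto
    have "suminf (e q z) = suminf ?g" unfolding eq o_def
      by (subst suminf_mono_reindex[OF sm z0]) auto
    also have "\<dots> \<le> suminf ?f"
      by (rule suminf_le[OF _ sg summable_poisson[OF z]]) (use z in auto)
    finally show "suminf (e q z) \<le> poisson_sum q z" by (simp add: poisson_sum_def)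
  qed
  \<comment> \<open>At \<open>q = 0\<close> the even terms form the cosh series, which keeps at
    least half of \<open>exp z\<close>.\<close>
  have cosh: "suminf (e 0 z) = cosh z" for z
  proof -
    let ?g = "\<lambda>n. if even n then z ^ n /\<^sub>R fact n else 0"
    have "?g sums cosh z" by (rule cosh_converges)
    moreover have "(\<lambda>k. ?g (2 * k)) sums s \<longleftrightarrow> ?g sums s" for s
      by (rule sums_mono_reindex[OF sm]) auto
    ultimately have "(\<lambda>k. ?g (2 * k)) sums cosh z" by blast
    moreover have "(\<lambda>k. ?g (2 * k)) = e 0 z" by (simp add: e_def fun_eq_iff divide_inverse mult.commute)
    ultimately show ?thesis by (simp add: sums_iff)
  qed
  have low: "1 / (4 * C') * exp z * (1 + z) powr q \<le> suminf (e q z)" if z: "z > 0" for z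
  proof -
    define y where "y = 1 + z"
    have y: "y > 0" using z by (simp add: y_def)
    \<comment> \<open>The weights have product 1, and \<open>b\<close> is scaled so that the upper
      bound for exponent \<open>- q\<close> contributes exactly \<open>exp z / 2\<close>, half of
      the \<open>exp z \<le> 2 * cosh z\<close> on the other side.\<close>
    define a where "a = 2 * C' / y powr q"
    define b where "b = y powr q / (2 * C')"
    have ab: "a > 0" "b > 0" "a * b = 1" using y C' by (auto simp: a_def b_def)
    have amgm: "2 \<le> a * x + b / x" if "x > 0" for x
    proof -
      have "0 \<le> (a * x - 1)\<^sup>2 / (a * x)" using ab that by simp
      also have "\<dots> = a * x + 1 / (a * x) - 2" using ab that by (simp add: field_simps power2_eq_square)
      also have "1 / (a * x) = b / x" using ab that by (simp add: field_simps)
      finally show ?thesis by simp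
    qed
    have termwise: "2 * e 0 z k \<le> a * e q z k + b * e (- q) z k" for k
    proof -
      have "2 \<le> a * (real (2*k) + 1) powr q + b * (real (2*k) + 1) powr (- q)"
        using amgm[of "(real (2*k) + 1) powr q"] by (simp add: powr_minus_divide)
      from mult_left_mono[OF this, of "z ^ (2 * k) / fact (2 * k)"]
      show ?thesis using z by (simp add: e_def algebra_simps)
    qed
    have "2 * cosh z = (\<Sum>k. 2 * e 0 z k)" unfolding cosh[symmetric] using sume[OF z] by (simp add: suminf_mult)
    also have "\<dots> \<le> (\<Sum>k. a * e q z k + b * e (- q) z k)"
      by (intro suminf_le termwise summable_add summable_mult sume z)
    also have "\<dots> = a * suminf (e q z) + b * suminf (e (- q) z)"
      using sume[OF z] by (simp only: suminf_add[symmetric] suminf_mult summable_mult)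
    also have "\<dots> \<le> a * suminf (e q z) + b * (C' * exp z * y powr (- q))"
      using ab order_trans[OF lee[OF z] C'(2)[OF z]] by (intro add_mono mult_left_mono) (auto simp: y_def)
    also have "b * (C' * exp z * y powr (- q)) = exp z / 2"
      using y C' by (simp add: b_def powr_minus field_simps)
    finally have "2 * cosh z \<le> a * suminf (e q z) + exp z / 2" .
    moreover have "exp z \<le> 2 * cosh z" by (simp add: cosh_field_def)
    ultimately have "exp z / 2 \<le> a * suminf (e q z)" by linarith
    then show ?thesis using y C' by (simp add: a_def y_def field_simps)
  qed
  show ?thesis
  proof (rule that[of "1 / (4 * C')" C])
    fix z :: real assume z: "z > 0"
    show "summable (\<lambda>k. z ^ (2 * k) / fact (2 * k) * (real (2 * k) + 1) powr q)"
      using sume[OF z, of q] by (simp only: e_def[abs_def])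
    show "1 / (4 * C') * exp z * (1 + z) powr q
        \<le> (\<Sum>k. z ^ (2 * k) / fact (2 * k) * (real (2 * k) + 1) powr q)"
      using low[OF z] by (simp only: e_def[abs_def])
    show "(\<Sum>k. z ^ (2 * k) / fact (2 * k) * (real (2 * k) + 1) powr q) \<le> C * exp z * (1 + z) powr q"
      using order_trans[OF lee[OF z] C(2)[OF z]] by (simp only: e_def[abs_def])
  qed (use C C' in auto)
qed

section \<open>Two-sided bounds for the Bessel heat kernel\<close>

text \<open>Up to the factor \<open>Gamma (\<zeta> + 1/2)\<close> this is a ratio of Pochhammer
  symbols whose parameters differ by \<open>\<zeta>\<close>, so it decays like
  \<open>k powr (- \<zeta>)\<close> by Euler's limit for Gamma. Positivity for every
  \<open>k\<close> turns the positive limit into uniform bounds.\<close>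

lemma pochhammer_div_Gamma_bounds:
  fixes \<zeta> :: real
  assumes "\<zeta> > -1/2"
  obtains c C where "c > 0" "C > 0"
    "\<And>k. c * (real (2 * k) + 1) powr (- \<zeta>) \<le> pochhammer (1/2) k / Gamma (real k + \<zeta> + 1/2)"
    "\<And>k. pochhammer (1/2) k / Gamma (real k + \<zeta> + 1/2) \<le> C * (real (2 * k) + 1) powr (- \<zeta>)"
proof -
  define a where "a = \<zeta> + 1/2"
  have a: "a > 0" using assms by (simp add: a_def)
  define f where "f k = pochhammer (1/2) k / Gamma (real k + a) * (real (2 * k) + 1) powr \<zeta>" for k
  have pa: "Gamma (real k + a) = pochhammer a k * Gamma a" for k
  proof -
    have "a \<notin> \<int>\<^sub>\<le>\<^sub>0" using a by (auto elim!: nonpos_Ints_cases)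
    then show ?thesis
      using pochhammer_Gamma[of a k] Gamma_real_pos[OF a] by (simp add: add.commute)
  qed
  have pos: "f k > 0" for k
    using a by (simp add: f_def pochhammer_pos)
  \<comment> \<open>\<open>Gamma_series a n\<close> contains the Pochhammer symbol of length
    \<open>n + 1\<close>, hence the limit is taken along \<open>f (Suc n)\<close>.\<close>
  have "(\<lambda>n. Gamma_series a n / Gamma_series (1/2) n * ((real (2 * Suc n) + 1) / real n) powr \<zeta> / Gamma a)
      \<longlonglongrightarrow> Gamma a / Gamma (1/2) * 2 powr \<zeta> / Gamma a"
  proof (intro tendsto_intros Gamma_series_LIMSEQ)
    show "(\<lambda>n. ((real (2 * Suc n) + 1) / real n)) \<longlonglongrightarrow> 2" by real_asymp
  qed (use Gamma_real_pos[OF a] in \<open>auto simp: Gamma_one_half_real\<close>)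
  moreover have "eventually (\<lambda>n. Gamma_series a n / Gamma_series (1/2) n * ((real (2 * Suc n) + 1) / real n) powr \<zeta> / Gamma a
      = f (Suc n)) sequentially"
    using eventually_gt_at_top[of 0]
  proof eventually_elim
    case (elim n)
    have e: "exp (x * ln (real n)) = real n powr x" for x using elim by (simp add: powr_def)
    have p: "pochhammer (1/2) (Suc n) > (0::real)" "pochhammer a (Suc n) > 0" "Gamma a > 0"
      using a by (auto intro: pochhammer_pos)
    have g: "Gamma_series a n / Gamma_series (1/2) n
        = pochhammer (1/2) (Suc n) / pochhammer a (Suc n) * (real n powr a / real n powr (1/2))"
      unfolding Gamma_series_def using p by (simp add: e e[of "1/2", simplified] del: pochhammer_Suc)
    have h: "real n powr a / real n powr (1/2) = real n powr \<zeta>"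
      by (simp add: a_def powr_diff[symmetric])
    have d: "((real (2 * Suc n) + 1) / real n) powr \<zeta> = (real (2 * Suc n) + 1) powr \<zeta> / real n powr \<zeta>"
      by (rule powr_divide)
    have "x / y * u * (v / u) / w = x / (y * w) * v" if "u \<noteq> 0" for x y u v w :: real
      using that by simp
    then show ?case using elim unfolding g f_def pa h d by simp
  qed
  ultimately have "(\<lambda>n. f (Suc n)) \<longlonglongrightarrow> Gamma a / Gamma (1/2) * 2 powr \<zeta> / Gamma a"
    by (rule Lim_transform_eventually)
  then have lim: "f \<longlonglongrightarrow> Gamma a / Gamma (1/2) * 2 powr \<zeta> / Gamma a" by (simp only: filterlim_sequentially_Suc)
  have Lpos: "Gamma a / Gamma (1/2) * 2 powr \<zeta> / Gamma a > 0"
    using a Gamma_real_pos[OF a] by (intro divide_pos_pos mult_pos_pos) auto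
  obtain c C where cC: "c > 0" "C > 0" "\<And>n. c \<le> f n" "\<And>n. f n \<le> C"
    by (rule pos_limit_imp_bounds[OF lim Lpos pos], rule that)
  show ?thesis
  proof (rule that[of c C])
    fix k
    show "c * (real (2 * k) + 1) powr (- \<zeta>) \<le> pochhammer (1/2) k / Gamma (real k + \<zeta> + 1/2)"
      using cC(3)[of k] by (simp add: f_def a_def powr_minus field_simps)
    show "pochhammer (1/2) k / Gamma (real k + \<zeta> + 1/2) \<le> C * (real (2 * k) + 1) powr (- \<zeta>)"
      using cC(4)[of k] by (simp add: f_def a_def powr_minus field_simps)
  qed (use cC in auto)
qed

lemma bessel_I_bounds:
  fixes \<zeta> :: real
  assumes "\<zeta> > -1/2"
  obtains c C where "c > 0" "C > 0"
    "\<And>z. z > 0 \<Longrightarrow> c * (z / 2) powr (\<zeta> - 1/2) * exp z * (1 + z) powr (- \<zeta>) \<le> bessel_I (\<zeta> - 1/2) z"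
    "\<And>z. z > 0 \<Longrightarrow> bessel_I (\<zeta> - 1/2) z \<le> C * (z / 2) powr (\<zeta> - 1/2) * exp z * (1 + z) powr (- \<zeta>)"
proof -
  obtain c1 C1 where 1: "c1 > 0" "C1 > 0"
    "\<And>k. c1 * (real (2 * k) + 1) powr (- \<zeta>) \<le> pochhammer (1/2) k / Gamma (real k + \<zeta> + 1/2)"
    "\<And>k. pochhammer (1/2) k / Gamma (real k + \<zeta> + 1/2) \<le> C1 * (real (2 * k) + 1) powr (- \<zeta>)"
    by (rule pochhammer_div_Gamma_bounds[OF assms], rule that)
  define e where "e z k = z ^ (2 * k) / fact (2 * k) * (real (2 * k) + 1) powr (- \<zeta>)" for z k
  have e_eq: "e z = (\<lambda>k. z ^ (2 * k) / fact (2 * k) * (real (2 * k) + 1) powr (- \<zeta>))" for z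
    by (simp add: e_def fun_eq_iff)
  obtain c2 C2 where 2: "c2 > 0" "C2 > 0" "\<And>z. z > 0 \<Longrightarrow> summable (e z)"
    "\<And>z. z > 0 \<Longrightarrow> c2 * exp z * (1 + z) powr (- \<zeta>) \<le> suminf (e z)"
    "\<And>z. z > 0 \<Longrightarrow> suminf (e z) \<le> C2 * exp z * (1 + z) powr (- \<zeta>)"
    by (rule even_poisson_sum_bounds[of "- \<zeta>"], rule that[unfolded e_eq])
  define b where "b z k = z ^ (2 * k) / fact (2 * k) * (pochhammer (1/2) k / Gamma (real k + \<zeta> + 1/2))" for z k
  have le: "c1 * e z k \<le> b z k" "b z k \<le> C1 * e z k" "0 \<le> e z k" if "z > 0" for z k
  proof -
    have w: "0 \<le> z ^ (2 * k) / fact (2 * k)" by simp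
    from mult_left_mono[OF 1(3)[of k] w] show "c1 * e z k \<le> b z k" by (simp add: e_def b_def mult_ac)
    from mult_left_mono[OF 1(4)[of k] w] show "b z k \<le> C1 * e z k" by (simp add: e_def b_def mult_ac)
    show "0 \<le> e z k" by (simp add: e_def)
  qed
  have sb: "summable (b z)" if z: "z > 0" for z
  proof (rule summable_comparison_test'[where N = 0, OF summable_mult[OF 2(3)[OF z], of C1]])
    fix k
    have "0 \<le> b z k" using le[OF z, of k] 1(1) by (smt (verit) mult_nonneg_nonneg)
    then show "norm (b z k) \<le> C1 * e z k" using le(2)[OF z, of k] by simp
  qed
  have eq: "bessel_I (\<zeta> - 1/2) z = (z / 2) powr (\<zeta> - 1/2) * suminf (b z)" if z: "z > 0" for z
  proof -
    have "(z / 2) powr (2 * real k + (\<zeta> - 1/2)) / (fact k * Gamma (real k + (\<zeta> - 1/2) + 1))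
        = (z / 2) powr (\<zeta> - 1/2) * b z k" for k
    proof -
      have p1: "(z / 2) powr (2 * real k) = z ^ (2 * k) / 2 ^ (2 * k)"
        using z powr_realpow[of "z / 2" "2 * k"] by (simp add: power_divide)
      have p2: "fact (2 * k) = (2 ^ (2 * k) * pochhammer (1/2) k * fact k :: real)"
        by (simp add: fact_double)
      have p3: "pochhammer (1/2) k > (0::real)" by (simp add: pochhammer_pos)
      have p4: "real k + (\<zeta> - 1/2) + 1 = real k + \<zeta> + 1/2" by simp
      show ?thesis unfolding powr_add b_def p1 p2 p4 using p3 by (simp add: mult_ac)
    qed
    then show ?thesis unfolding bessel_I_def using sb[OF z] by (simp add: suminf_mult)
  qed
  have lo: "c1 * suminf (e z) \<le> suminf (b z)" if z: "z > 0" for z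
    using suminf_le[OF le(1)[OF z] summable_mult[OF 2(3)[OF z]] sb[OF z]] suminf_mult[OF 2(3)[OF z]] by simp
  have up: "suminf (b z) \<le> C1 * suminf (e z)" if z: "z > 0" for z
    using suminf_le[OF le(2)[OF z] sb[OF z] summable_mult[OF 2(3)[OF z]]] suminf_mult[OF 2(3)[OF z]] by simp
  show ?thesis
  proof (rule that[of "c1 * c2" "C1 * C2"])
    fix z :: real assume z: "z > 0"
    have "c1 * (c2 * exp z * (1 + z) powr (- \<zeta>)) \<le> suminf (b z)"
      using order_trans[OF mult_left_mono[OF 2(4)[OF z]] lo[OF z]] 1(1) by simp
    from mult_left_mono[OF this, of "(z / 2) powr (\<zeta> - 1/2)"]
    show "c1 * c2 * (z / 2) powr (\<zeta> - 1/2) * exp z * (1 + z) powr (- \<zeta>) \<le> bessel_I (\<zeta> - 1/2) z"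
      unfolding eq[OF z] by (simp add: mult_ac)
    have "suminf (b z) \<le> C1 * (C2 * exp z * (1 + z) powr (- \<zeta>))"
      using order_trans[OF up[OF z] mult_left_mono[OF 2(5)[OF z]]] 1(2) by simp
    from mult_left_mono[OF this, of "(z / 2) powr (\<zeta> - 1/2)"]
    show "bessel_I (\<zeta> - 1/2) z \<le> C1 * C2 * (z / 2) powr (\<zeta> - 1/2) * exp z * (1 + z) powr (- \<zeta>)"
      unfolding eq[OF z] by (simp add: mult_ac)
  qed (use 1 2 in auto)
qed

definition heat_profile :: "real \<Rightarrow> real \<Rightarrow> real \<Rightarrow> real \<Rightarrow> real" where
  "heat_profile \<zeta> t r s = t powr (-1/2) * exp (- (r - s)\<^sup>2 / (4 * t)) / (r * s + t) powr \<zeta>"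

text \<open>With \<open>z = r * s / (2 * t)\<close>, completing the square merges the exponentials,
  and the powers of \<open>r * s\<close> outside \<open>1 + z\<close> cancel. What remains is
  \<open>(r * s + 2 * t) powr (- \<zeta>)\<close>, comparable to the power of
  \<open>r * s + t\<close> within \<open>2 powr \<bar>\<zeta>\<bar>\<close>.\<close>

lemma bessel_heat_bounds:
  fixes \<zeta> :: real
  assumes "\<zeta> > -1/2"
  obtains c C where "c > 0" "C > 0"
    "\<And>r s t. r > 0 \<Longrightarrow> s > 0 \<Longrightarrow> t > 0 \<Longrightarrow> c * heat_profile \<zeta> t r s \<le> bessel_heat \<zeta> t r s"
    "\<And>r s t. r > 0 \<Longrightarrow> s > 0 \<Longrightarrow> t > 0 \<Longrightarrow> bessel_heat \<zeta> t r s \<le> C * heat_profile \<zeta> t r s"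
proof -
  obtain c C where 1: "c > 0" "C > 0"
    "\<And>z. z > 0 \<Longrightarrow> c * (z / 2) powr (\<zeta> - 1/2) * exp z * (1 + z) powr (- \<zeta>) \<le> bessel_I (\<zeta> - 1/2) z"
    "\<And>z. z > 0 \<Longrightarrow> bessel_I (\<zeta> - 1/2) z \<le> C * (z / 2) powr (\<zeta> - 1/2) * exp z * (1 + z) powr (- \<zeta>)"
    by (rule bessel_I_bounds[OF assms], rule that)
  \<comment> \<open>The powers of 2 left over after the cancellation:
    \<open>4 powr (1/2 - \<zeta>) * 2 powr \<zeta> / 2\<close>.\<close>
  define m where "m = (2::real) powr (- \<zeta>)"
  define k where "k = (2::real) powr \<bar>\<zeta>\<bar>"
  have m: "m > 0" and k: "k > 0" by (auto simp: m_def k_def)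
  have both: "c * m / k * heat_profile \<zeta> t r s \<le> bessel_heat \<zeta> t r s \<and>
     bessel_heat \<zeta> t r s \<le> C * m * k * heat_profile \<zeta> t r s"
    if rst: "r > 0" "s > 0" "t > 0" for r s t
  proof -
    define z where "z = r * s / (2 * t)"
    have z: "z > 0" using rst by (simp add: z_def)
    define W where "W = (r * s) powr (1/2 - \<zeta>) / (2 * t) * exp (- (r\<^sup>2 + s\<^sup>2) / (4 * t))"
    have W: "W \<ge> 0" using rst by (simp add: W_def)
    have heat: "bessel_heat \<zeta> t r s = W * bessel_I (\<zeta> - 1/2) z"
      by (simp add: bessel_heat_def W_def z_def)
    define E where "E = t powr (-1/2) * exp (- (r - s)\<^sup>2 / (4 * t))"
    have E: "E > 0" using rst by (simp add: E_def)
    have ex: "exp (- (r\<^sup>2 + s\<^sup>2) / (4 * t)) * exp z = exp (- (r - s)\<^sup>2 / (4 * t))"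
      unfolding exp_add[symmetric] z_def using rst
      by (intro arg_cong[where f = exp]) (simp add: field_simps power2_eq_square)
    have z1: "1 + z = (r * s + 2 * t) / (2 * t)" using rst by (simp add: z_def field_simps)
    have "(r * s) powr (1/2 - \<zeta>) * (z / 2) powr (\<zeta> - 1/2) = (4 * t) powr (1/2 - \<zeta>)"
    proof -
      have "z / 2 = (r * s) / (4 * t)" by (simp add: z_def)
      then have "(z / 2) powr (\<zeta> - 1/2) = (r * s) powr (\<zeta> - 1/2) / (4 * t) powr (\<zeta> - 1/2)"
        using rst by (simp only: powr_divide)
      moreover have "(r * s) powr (\<zeta> - 1/2) = 1 / (r * s) powr (1/2 - \<zeta>)"
        using powr_minus_divide[of "r * s" "1/2 - \<zeta>"] by simp
      moreover have "(4 * t) powr (\<zeta> - 1/2) = 1 / (4 * t) powr (1/2 - \<zeta>)"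
        using powr_minus_divide[of "4 * t" "1/2 - \<zeta>"] by simp
      ultimately show ?thesis using rst by simp
    qed
    moreover have "(4 * t) powr (1/2 - \<zeta>) / (2 * t) * (2 * t) powr \<zeta> = m * t powr (-1/2)"
    proof -
      have "(4 * t) powr (1/2 - \<zeta>) = 4 powr (1/2 - \<zeta>) * t powr (1/2 - \<zeta>)" 
        using rst by (simp add: powr_mult)
      also have "(4::real) powr (1/2 - \<zeta>) = 2 powr (1 - 2 * \<zeta>)"
        using powr_powr[of 2 2 "1/2 - \<zeta>"] by (simp add: algebra_simps)
      finally have A: "(4 * t) powr (1/2 - \<zeta>) / (2 * t) * (2 * t) powr \<zeta>
          = (2 powr (1 - 2 * \<zeta>) * 2 powr \<zeta> / 2) * (t powr (1/2 - \<zeta>) * t powr \<zeta> / t)"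
        using rst by (simp add: powr_mult)
      have "(2::real) powr (1 - 2 * \<zeta>) * 2 powr \<zeta> = 2 powr (1 + (- \<zeta>))"
        unfolding powr_add[symmetric] by simp
      then have B: "2 powr (1 - 2 * \<zeta>) * 2 powr \<zeta> / 2 = m" unfolding powr_add m_def by simp
      have "t powr (1/2 - \<zeta>) * t powr \<zeta> = t powr (1 + (-1/2))"
        unfolding powr_add[symmetric] by simp
      then have C: "t powr (1/2 - \<zeta>) * t powr \<zeta> / t = t powr (-1/2)"
        unfolding powr_add using rst by simp
      show ?thesis unfolding A B C ..
    qed
    ultimately have key: "W * ((z / 2) powr (\<zeta> - 1/2) * exp z * (1 + z) powr (- \<zeta>))
        = m * E * (r * s + 2 * t) powr (- \<zeta>)"
    proof -
      assume a1: "(r * s) powr (1/2 - \<zeta>) * (z / 2) powr (\<zeta> - 1/2) = (4 * t) powr (1/2 - \<zeta>)"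
        and a2: "(4 * t) powr (1/2 - \<zeta>) / (2 * t) * (2 * t) powr \<zeta> = m * t powr (-1/2)"
      have a3: "(1 + z) powr (- \<zeta>) = (r * s + 2 * t) powr (- \<zeta>) * (2 * t) powr \<zeta>"
        unfolding z1 using rst by (simp add: powr_divide powr_minus field_simps)
      have "W * ((z / 2) powr (\<zeta> - 1/2) * exp z * (1 + z) powr (- \<zeta>))
        = ((r * s) powr (1/2 - \<zeta>) * (z / 2) powr (\<zeta> - 1/2)) / (2 * t) * (2 * t) powr \<zeta>
          * (exp (- (r\<^sup>2 + s\<^sup>2) / (4 * t)) * exp z) * (r * s + 2 * t) powr (- \<zeta>)"
        unfolding W_def a3 by (simp add: mult_ac)
      then show ?thesis unfolding a1 a2 ex E_def by (simp add: mult_ac)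
    qed
    have rs: "r * s > 0" using rst by simp
    have c1: "(r * s + 2 * t) powr (- \<zeta>) \<le> k * (r * s + t) powr (- \<zeta>)"
      unfolding k_def using powr_le_const_mult_powr[of "r * s + 2 * t" "r * s + t" 2 "- \<zeta>"] rst rs by simp
    have c2: "(r * s + t) powr (- \<zeta>) \<le> k * (r * s + 2 * t) powr (- \<zeta>)"
      unfolding k_def using powr_le_const_mult_powr[of "r * s + t" "r * s + 2 * t" 2 "- \<zeta>"] rst rs by simp
    have prof: "heat_profile \<zeta> t r s = E * (r * s + t) powr (- \<zeta>)"
      by (simp add: heat_profile_def E_def powr_minus field_simps)
    have "c * m / k * heat_profile \<zeta> t r s \<le> c * m / k * (E * (k * (r * s + 2 * t) powr (- \<zeta>)))"
      unfolding prof using 1 m k E c2 by (intro mult_left_mono) auto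
    also have "\<dots> = c * (m * E * (r * s + 2 * t) powr (- \<zeta>))" using k by simp
    also have "\<dots> = W * (c * (z / 2) powr (\<zeta> - 1/2) * exp z * (1 + z) powr (- \<zeta>))"
      unfolding key[symmetric] by (simp add: mult_ac)
    also have "\<dots> \<le> bessel_heat \<zeta> t r s"
      unfolding heat by (intro mult_left_mono W 1(3) z)
    finally have A: "c * m / k * heat_profile \<zeta> t r s \<le> bessel_heat \<zeta> t r s" .
    have "bessel_heat \<zeta> t r s \<le> W * (C * (z / 2) powr (\<zeta> - 1/2) * exp z * (1 + z) powr (- \<zeta>))"
      unfolding heat by (intro mult_left_mono W 1(4) z)
    also have "\<dots> = C * (m * E * (r * s + 2 * t) powr (- \<zeta>))"
      unfolding key[symmetric] by (simp add: mult_ac)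
    also have "\<dots> \<le> C * (m * E * (k * (r * s + t) powr (- \<zeta>)))"
      using 1 m k E c1 by (intro mult_left_mono) auto
    also have "\<dots> = C * m * k * heat_profile \<zeta> t r s" unfolding prof by (simp add: mult_ac)
    finally show ?thesis using A by blast
  qed
  show ?thesis
    using 1 m k both by (intro that[of "c * m / k" "C * m * k"]) auto
qed

lemma bessel_heat_nonneg:
  assumes "\<zeta> > -1/2" "r > 0" "s > 0" "t > 0"
  shows "bessel_heat \<zeta> t r s \<ge> 0"
proof -
  obtain c C where c: "c > 0"
    "\<And>r s t. r > 0 \<Longrightarrow> s > 0 \<Longrightarrow> t > 0 \<Longrightarrow> c * heat_profile \<zeta> t r s \<le> bessel_heat \<zeta> t r s"
    by (rule bessel_heat_bounds[OF assms(1)], rule that)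
  have "0 \<le> c * heat_profile \<zeta> t r s" using c(1) by (simp add: heat_profile_def)
  then show ?thesis using c(2)[OF assms(2-4)] by linarith
qed

section \<open>Comparison of the bounding functions\<close>

text \<open>With \<open>x = \<bar>r - s\<bar> / sqrt t\<close> the Gaussian of
  \<open>heat_profile\<close> has exponent \<open>- x\<^sup>2 / 4\<close>; the bound spends half of
  it.\<close>

lemma powr_le_exp_square:
  fixes p :: real
  assumes "p \<ge> 0"
  obtains K where "K > 0" "\<And>x. x \<ge> 0 \<Longrightarrow> (2 * (1 + x)) powr p \<le> K * exp (x\<^sup>2 / 8)"
proof -
  have "((\<lambda>x::real. (2 * (1 + x)) powr p * exp (- x\<^sup>2 / 8)) \<longlongrightarrow> 0) at_top" by real_asymp
  then have "eventually (\<lambda>x::real. (2 * (1 + x)) powr p * exp (- x\<^sup>2 / 8) < 1) at_top"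
    by (rule order_tendstoD) simp
  then obtain N where N: "\<And>x. x \<ge> N \<Longrightarrow> (2 * (1 + x)) powr p * exp (- x\<^sup>2 / 8) < 1"
    by (auto simp: eventually_at_top_linorder)
  show ?thesis
  proof (rule that[of "1 + (2 * (1 + \<bar>N\<bar>)) powr p"])
    fix x :: real assume x: "x \<ge> 0"
    have e: "1 \<le> exp (x\<^sup>2 / 8)" by simp
    show "(2 * (1 + x)) powr p \<le> (1 + (2 * (1 + \<bar>N\<bar>)) powr p) * exp (x\<^sup>2 / 8)"
    proof (cases "x \<ge> N")
      case True
      then have "(2 * (1 + x)) powr p \<le> exp (x\<^sup>2 / 8)" using N[OF True] by (simp add: exp_minus field_simps)
      then show ?thesis by (smt (verit) e mult_le_cancel_right1 powr_ge_zero)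
    next
      case False
      then have "(2 * (1 + x)) powr p \<le> (2 * (1 + \<bar>N\<bar>)) powr p" using x assms by (intro powr_mono2) auto
      then have "(2 * (1 + x)) powr p \<le> 1 + (2 * (1 + \<bar>N\<bar>)) powr p" by simp
      also have "\<dots> \<le> (1 + (2 * (1 + \<bar>N\<bar>)) powr p) * exp (x\<^sup>2 / 8)"
        using mult_left_mono[OF e, of "1 + (2 * (1 + \<bar>N\<bar>)) powr p"] by (simp add: add_nonneg_nonneg)
      finally show ?thesis .
    qed
  qed (simp add: add_pos_nonneg)
qed

text \<open>Because \<open>min 1 (x / sqrt t) = x / max x (sqrt t)\<close>, the numerators cancel
  against \<open>1 / (r * s)\<close>.\<close>

lemma A_zeta_eq:
  assumes "r > 0" "s > 0" "t > 0"
  shows "A_zeta \<zeta> t r s = (max r (sqrt t) * max s (sqrt t)) powr (- \<zeta>) * t powr (-1/2)"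
proof -
  have 1: "min 1 (x / sqrt t) = x / max x (sqrt t)" if "x > 0" for x
    using assms that by (auto simp: min_def max_def field_simps)
  have "min 1 (r / sqrt t) powr \<zeta> * min 1 (s / sqrt t) powr \<zeta> * (1 / (r * s)) powr \<zeta>
      = (r / max r (sqrt t) * (s / max s (sqrt t)) * (1 / (r * s))) powr \<zeta>"
    unfolding 1[OF assms(1)] 1[OF assms(2)] using assms by (simp only: powr_mult)
  also have "r / max r (sqrt t) * (s / max s (sqrt t)) * (1 / (r * s))
      = 1 / (max r (sqrt t) * max s (sqrt t))" using assms by simp
  also have "(1 / (max r (sqrt t) * max s (sqrt t))) powr \<zeta> = (max r (sqrt t) * max s (sqrt t)) powr (- \<zeta>)"
    by (simp add: powr_minus powr_divide inverse_eq_divide)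
  finally show ?thesis by (simp add: A_zeta_def)
qed

text \<open>\<open>r * s + t \<le> 2 * M\<close> holds outright. The reverse is delicate when
  \<open>sqrt t\<close> separates \<open>r\<close> from \<open>s\<close>: then the larger one is at
  most \<open>sqrt t + \<bar>r - s\<bar>\<close>, which is where \<open>k\<close> comes from. One
  \<open>k\<close> serves both directions, as \<open>powr_le_const_mult_powr\<close>
  demands.\<close>

lemma max_sqrt_product_bounds:
  fixes r s t :: real
  assumes "r > 0" "s > 0" "t > 0"
  defines "M \<equiv> max r (sqrt t) * max s (sqrt t)" and "k \<equiv> 2 * (1 + \<bar>r - s\<bar> / sqrt t)"
  shows "M \<le> k * (r * s + t)" "r * s + t \<le> k * M"
proof -
  define q where "q = sqrt t"
  have q: "q > 0" "t = q * q" using assms by (auto simp: q_def)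
  define d where "d = \<bar>r - s\<bar> / q"
  have d: "d \<ge> 0" "d * q = \<bar>r - s\<bar>" using q by (auto simp: d_def)
  have rs: "r * s > 0" using assms by simp
  have mixed: "x * q \<le> (1 + d) * (r * s + q * q)" if "x \<le> q + \<bar>r - s\<bar>" for x
  proof -
    have "x * q \<le> (q + d * q) * q" using that d q by (intro mult_right_mono) auto
    also have "\<dots> = (1 + d) * (q * q)" by (simp add: algebra_simps)
    also have "\<dots> \<le> (1 + d) * (r * s + q * q)" using d rs by (intro mult_left_mono) auto
    finally show ?thesis .
  qed
  have "max r q * max s q \<le> (1 + d) * (r * s + q * q)"
  proof (cases "r \<ge> q"; cases "s \<ge> q")
    assume "r \<ge> q" "s \<ge> q"
    then have "max r q * max s q = r * s" by simp
    also have "\<dots> \<le> 1 * (r * s + q * q)" using q by simp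
    also have "\<dots> \<le> (1 + d) * (r * s + q * q)" using d rs q by (intro mult_right_mono) auto
    finally show ?thesis .
  next
    assume "\<not> r \<ge> q" "\<not> s \<ge> q"
    then have "max r q * max s q = q * q" by simp
    also have "\<dots> \<le> 1 * (r * s + q * q)" using rs by simp
    also have "\<dots> \<le> (1 + d) * (r * s + q * q)" using d rs q by (intro mult_right_mono) auto
    finally show ?thesis .
  next
    assume a: "r \<ge> q" "\<not> s \<ge> q"
    then have "max r q * max s q = r * q" by simp
    then show ?thesis using mixed[of r] a by simp
  next
    assume a: "\<not> r \<ge> q" "s \<ge> q"
    then have "max r q * max s q = s * q" by simp
    then show ?thesis using mixed[of s] a by (simp add: mult.commute)
  qed
  also have "\<dots> \<le> 2 * (1 + d) * (r * s + q * q)" using d rs q by (intro mult_right_mono) auto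
  finally show "M \<le> k * (r * s + t)" unfolding M_def k_def using assms by (simp add: q_def d_def)
  have "r * s \<le> max r q * max s q" "q * q \<le> max r q * max s q"
    using assms q by (auto intro!: mult_mono)
  then have "r * s + q * q \<le> 2 * (max r q * max s q)" by linarith
  also have "\<dots> \<le> (2 * (1 + d)) * (max r q * max s q)"
    using d q assms by (intro mult_right_mono) auto
  finally show "r * s + t \<le> k * M" unfolding M_def k_def using assms by (simp add: q_def d_def)
qed

text \<open>Exchanging the bases costs at most \<open>K * exp (x\<^sup>2 / 8)\<close>. The Gaussian
  constants solve \<open>- 3/8 + 1/8 = - 1/4\<close>, giving \<open>8/3\<close>, and
  \<open>- 1/4 + 1/8 = - 1/8\<close>, giving \<open>8\<close>.\<close>

lemma A_zeta_bounds:
  obtains K where "K > 0"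
    "\<And>r s t. r > 0 \<Longrightarrow> s > 0 \<Longrightarrow> t > 0 \<Longrightarrow>
       A_zeta \<zeta> t r s * exp (- (r - s)\<^sup>2 / (8/3 * t)) \<le> K * heat_profile \<zeta> t r s \<and>
       heat_profile \<zeta> t r s \<le> K * (A_zeta \<zeta> t r s * exp (- (r - s)\<^sup>2 / (8 * t)))"
proof -
  obtain K where K: "K > 0" "\<And>x. x \<ge> 0 \<Longrightarrow> (2 * (1 + x)) powr \<bar>\<zeta>\<bar> \<le> K * exp (x\<^sup>2 / 8)"
    by (rule powr_le_exp_square[of "\<bar>\<zeta>\<bar>"], simp, rule that)
  have "A_zeta \<zeta> t r s * exp (- (r - s)\<^sup>2 / (8/3 * t)) \<le> K * heat_profile \<zeta> t r s \<and>
       heat_profile \<zeta> t r s \<le> K * (A_zeta \<zeta> t r s * exp (- (r - s)\<^sup>2 / (8 * t)))"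
    if rst: "r > 0" "s > 0" "t > 0" for r s t
  proof -
    define M where "M = max r (sqrt t) * max s (sqrt t)"
    define x where "x = \<bar>r - s\<bar> / sqrt t"
    define N where "N = r * s + t"
    have x: "x \<ge> 0" "x\<^sup>2 = (r - s)\<^sup>2 / t" using rst by (auto simp: x_def power_divide)
    have MN: "M > 0" "N > 0" using rst by (auto simp: M_def N_def add_pos_pos max_def)
    have b: "M \<le> 2 * (1 + x) * N" "N \<le> 2 * (1 + x) * M"
      using max_sqrt_product_bounds[OF rst] by (auto simp: M_def N_def x_def)
    have "M powr (- \<zeta>) \<le> (2 * (1 + x)) powr \<bar>- \<zeta>\<bar> * N powr (- \<zeta>)"
      using MN b x by (intro powr_le_const_mult_powr) auto
    also have "\<dots> \<le> (K * exp (x\<^sup>2 / 8)) * N powr (- \<zeta>)"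
      using K(2)[OF x(1)] by (intro mult_right_mono) auto
    finally have 1: "M powr (- \<zeta>) \<le> K * exp (x\<^sup>2 / 8) * N powr (- \<zeta>)" .
    have "N powr (- \<zeta>) \<le> (2 * (1 + x)) powr \<bar>- \<zeta>\<bar> * M powr (- \<zeta>)"
      using MN b x by (intro powr_le_const_mult_powr) auto
    also have "\<dots> \<le> (K * exp (x\<^sup>2 / 8)) * M powr (- \<zeta>)"
      using K(2)[OF x(1)] by (intro mult_right_mono) auto
    finally have 2: "N powr (- \<zeta>) \<le> K * exp (x\<^sup>2 / 8) * M powr (- \<zeta>)" .
    have A: "A_zeta \<zeta> t r s = M powr (- \<zeta>) * t powr (-1/2)"
      unfolding M_def by (rule A_zeta_eq[OF rst])
    have e1: "- (r - s)\<^sup>2 / (8/3 * t) = - 3 * x\<^sup>2 / 8" "- (r - s)\<^sup>2 / (8 * t) = - x\<^sup>2 / 8"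
      "- (r - s)\<^sup>2 / (4 * t) = - x\<^sup>2 / 4"
      using x rst by (auto simp: field_simps)
    have H: "heat_profile \<zeta> t r s = t powr (-1/2) * exp (- x\<^sup>2 / 4) * N powr (- \<zeta>)"
      unfolding heat_profile_def e1 N_def by (simp add: powr_minus field_simps)
    have "A_zeta \<zeta> t r s * exp (- 3 * x\<^sup>2 / 8)
        \<le> (K * exp (x\<^sup>2 / 8) * N powr (- \<zeta>)) * t powr (-1/2) * exp (- 3 * x\<^sup>2 / 8)"
      unfolding A using 1 by (intro mult_right_mono) auto
    also have "\<dots> = K * (t powr (-1/2) * (exp (x\<^sup>2 / 8) * exp (- 3 * x\<^sup>2 / 8)) * N powr (- \<zeta>))"
      by (simp add: mult_ac)
    also have "exp (x\<^sup>2 / 8) * exp (- 3 * x\<^sup>2 / 8) = exp (- x\<^sup>2 / 4)" unfolding exp_add[symmetric] by simp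
    finally have P: "A_zeta \<zeta> t r s * exp (- 3 * x\<^sup>2 / 8) \<le> K * heat_profile \<zeta> t r s" unfolding H .
    have "heat_profile \<zeta> t r s \<le> t powr (-1/2) * exp (- x\<^sup>2 / 4) * (K * exp (x\<^sup>2 / 8) * M powr (- \<zeta>))"
      unfolding H using 2 by (intro mult_left_mono) auto
    also have "\<dots> = K * (A_zeta \<zeta> t r s * (exp (x\<^sup>2 / 8) * exp (- x\<^sup>2 / 4)))"
      unfolding A by (simp add: mult_ac)
    also have "exp (x\<^sup>2 / 8) * exp (- x\<^sup>2 / 4) = exp (- x\<^sup>2 / 8)" unfolding exp_add[symmetric] by simp
    finally show ?thesis using P unfolding e1 by simp
  qed
  then show ?thesis using K(1) that[of K] by blast
qed

text \<open>Here \<open>t D powr (- \<alpha>)\<close> is the order of the probability that the subordinator exceeds \<open>D\<^sup>2\<close>,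
  and the other factor is the heat profile at time \<open>D\<^sup>2\<close> without its Gaussian.\<close>

lemma Q_bound_equiv:
  fixes \<zeta> \<alpha> :: real
  assumes z: "\<zeta> > -1/2" and \<alpha>: "\<alpha> > 0"
  obtains K where "K > 0"
    "\<And>r s t D. r > 0 \<Longrightarrow> s > 0 \<Longrightarrow> t > 0 \<Longrightarrow> D = max \<bar>r - s\<bar> (t powr (1 / \<alpha>)) \<Longrightarrow>
      Q_bound \<zeta> \<alpha> t r s \<le> K * (t * D powr (-\<alpha>) * (D powr (-1) * (r * s + D\<^sup>2) powr (- \<zeta>))) \<and>
      t * D powr (-\<alpha>) * (D powr (-1) * (r * s + D\<^sup>2) powr (- \<zeta>)) \<le> K * Q_bound \<zeta> \<alpha> t r s"
proof -
  define k where "k = (8::real) powr \<bar>\<zeta>\<bar>"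
  define l where "l = (2::real) powr (2 * \<bar>\<zeta>\<bar>)"
  have k1: "k \<ge> 1" and l1: "l \<ge> 1" by (auto simp: k_def l_def ge_one_powr_ge_zero)
  define K where "K = (1 + l) * k"
  have K: "K \<ge> k" "K > 0" using k1 l1 by (auto simp: K_def)
  \<comment> \<open>With \<open>T = t powr (1 / \<alpha>)\<close>, \<open>Q_bound\<close> is
    \<open>t / den\<close>, so the claim amounts to comparing \<open>den\<close> with
    \<open>D powr (1 + \<alpha>) * N powr \<zeta>\<close>.\<close>
  have main: "(1/k) * (D powr (1 + \<alpha>) * N powr \<zeta>) \<le> den \<and> den \<le> K * (D powr (1 + \<alpha>) * N powr \<zeta>)"
    if rst: "r > 0" "s > 0" "T > 0" and D: "D = max \<bar>r - s\<bar> T" and N: "N = r * s + D\<^sup>2"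
      and den: "den = \<bar>r - s\<bar> powr (1 + \<alpha>) * (r + s) powr (2 * \<zeta>) + T powr (1 + \<alpha>) * (T + r + s) powr (2 * \<zeta>)"
    for r s T D N den
  proof -
    define d where "d = \<bar>r - s\<bar>"
    have d: "0 \<le> d" "d \<le> r + s" "d\<^sup>2 = (r - s)\<^sup>2" using rst by (auto simp: d_def)
    have Dpos: "D > 0" using rst D by auto
    have rs: "r * s > 0" using rst by simp
    have Npos: "N > 0" unfolding N using rs Dpos by (simp add: add_pos_nonneg)
    have sq: "x powr (2 * \<zeta>) = (x\<^sup>2) powr \<zeta>" if "x > 0" for x :: real
      using that by (simp add: powr_powr[symmetric])
    have cmp: "x powr (2 * \<zeta>) \<le> k * N powr \<zeta>" "N powr \<zeta> \<le> k * x powr (2 * \<zeta>)"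
      if "x > 0" "N \<le> x\<^sup>2" "x\<^sup>2 \<le> 8 * N" for x
      unfolding sq[OF that(1)] k_def using that Npos
      by (auto intro!: powr_le_const_mult_powr)
    let ?X = "d powr (1 + \<alpha>) * (r + s) powr (2 * \<zeta>)"
    let ?Y = "T powr (1 + \<alpha>) * (T + r + s) powr (2 * \<zeta>)"
    have den': "den = ?X + ?Y" by (simp add: den d_def)
    have XY: "?X \<ge> 0" "?Y \<ge> 0" by auto
    have id: "(r + s)\<^sup>2 = d\<^sup>2 + 4 * (r * s)" unfolding d(3) by (simp add: power2_eq_square algebra_simps)
    \<comment> \<open>\<open>m\<close> is the dominant summand of \<open>den\<close> and
      \<open>x\<close> the base of its second factor; \<open>id\<close> is what ties
      \<open>x\<^sup>2\<close> to \<open>N\<close>.\<close>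
    obtain m x where mx: "m \<le> den" "den \<le> (1 + l) * m" "m = D powr (1 + \<alpha>) * x powr (2 * \<zeta>)"
      "x > 0" "N \<le> x\<^sup>2" "x\<^sup>2 \<le> 8 * N"
    proof (cases "d \<le> T")
      case True
      then have DT: "D = T" using D d_def by simp
      have dT: "d\<^sup>2 \<le> T\<^sup>2" using True d by (intro power_mono) auto
      have e: "(T + r + s)\<^sup>2 = T\<^sup>2 + 2 * (T * (r + s)) + (r + s)\<^sup>2" by (simp add: power2_eq_square algebra_simps)
      have "T * (r + s) \<ge> 0" using rst by simp
      then have lo: "N \<le> (T + r + s)\<^sup>2" unfolding N DT e id using rs zero_le_power2[of d] by linarith
      have "2 * (T * (r + s)) \<le> T\<^sup>2 + (r + s)\<^sup>2"
        using sum_squares_bound[of T "r + s"] by simp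
      moreover have "T\<^sup>2 + 2 * P + S \<le> 8 * (r * s + T\<^sup>2)" if "2 * P \<le> T\<^sup>2 + S" "S = d\<^sup>2 + 4 * (r * s)" for P S
        proof -
        have "T\<^sup>2 + 2 * P + S \<le> 2 * T\<^sup>2 + 2 * S" using that by linarith
        also have "\<dots> \<le> 4 * T\<^sup>2 + 8 * (r * s)" using that dT by linarith
        also have "\<dots> \<le> 8 * (r * s + T\<^sup>2)" by simp
        finally show ?thesis .
      qed
      ultimately have up: "(T + r + s)\<^sup>2 \<le> 8 * N" unfolding e N DT using id by blast
      have "?X \<le> l * ?Y"
      proof (cases "\<zeta> \<ge> 0")
        case z0: True
        have "?X \<le> ?Y" using z0 d True rst \<alpha> by (intro mult_mono powr_mono2) auto
        also have "\<dots> \<le> l * ?Y" using mult_right_mono[OF l1 XY(2)] by simp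
        finally show ?thesis .
      next
        case z0: False
        \<comment> \<open>For negative \<open>\<zeta>\<close> the factor
          \<open>(r + s) powr (2 * \<zeta>)\<close> blows up as \<open>r + s\<close> tends to 0, but
          \<open>d \<le> r + s\<close> compensates: \<open>g\<close> of the powers of
          \<open>d\<close> go into the quotient \<open>d / (r + s)\<close>, and \<open>g < 1\<close>
          leaves the exponent \<open>1 + \<alpha> - g\<close> positive.\<close>
        define g where "g = - 2 * \<zeta>"
        have g: "g > 0" "g < 1" "2 * \<zeta> = - g" "l = 2 powr g" using z z0 by (auto simp: g_def l_def)
        have split: "y powr (1 + \<alpha>) * x powr (2 * \<zeta>) = y powr (1 + \<alpha> - g) * (y / x) powr g"
          if "y \<ge> 0" "x > 0" for x y :: real
          using that g by (simp add: powr_divide powr_minus powr_diff field_simps)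
        have "d / (r + s) \<le> 2 * (T / (T + r + s))"
        proof -
          have "d * T \<le> (r + s) * T" "d * (r + s) \<le> T * (r + s)" using d True rst by (auto intro: mult_right_mono)
          then show ?thesis using rst by (simp add: field_simps)
        qed
        then have "(d / (r + s)) powr g \<le> (2 * (T / (T + r + s))) powr g"
          using g d rst by (intro powr_mono2) auto
        also have "\<dots> = l * (T / (T + r + s)) powr g" unfolding g(4) by (rule powr_mult)
        finally have "d powr (1 + \<alpha> - g) * (d / (r + s)) powr g \<le> T powr (1 + \<alpha> - g) * (l * (T / (T + r + s)) powr g)"
          using d True g \<alpha> rst by (intro mult_mono powr_mono2) auto
        then show ?thesis using split[of d "r + s"] split[of T "T + r + s"] d rst by (simp add: mult_ac)
      qed
      then show ?thesis using that[of ?Y "T + r + s"] lo up rst XY by (simp add: den' DT algebra_simps)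
    next
      case False
      then have DT: "D = d" using D d_def by simp
      have lo: "N \<le> (r + s)\<^sup>2" unfolding N DT id using rs by linarith
      have up: "(r + s)\<^sup>2 \<le> 8 * N" unfolding N DT id distrib_left using rs zero_le_power2[of d] by linarith
      \<comment> \<open>Here \<open>T < d \<le> r + s\<close>, so adding \<open>T\<close> at most
        doubles the base.\<close>
      have "(T + r + s) powr (2 * \<zeta>) \<le> 2 powr \<bar>2 * \<zeta>\<bar> * (r + s) powr (2 * \<zeta>)"
        using False d rst by (intro powr_le_const_mult_powr) auto
      then have "?Y \<le> d powr (1 + \<alpha>) * (l * (r + s) powr (2 * \<zeta>))"
        using False \<alpha> rst by (intro mult_mono powr_mono2) (auto simp: l_def abs_mult)
      then show ?thesis using that[of ?X "r + s"] lo up rst XY by (simp add: den' DT algebra_simps)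
    qed
    have "D powr (1 + \<alpha>) * N powr \<zeta> \<le> D powr (1 + \<alpha>) * (k * x powr (2 * \<zeta>))"
      using cmp(2)[OF mx(4-6)] by (intro mult_left_mono) auto
    also have "\<dots> = k * m" by (simp add: mx(3))
    finally have "(1/k) * (D powr (1 + \<alpha>) * N powr \<zeta>) \<le> m" using k1 by (simp add: field_simps)
    moreover have "m \<le> k * (D powr (1 + \<alpha>) * N powr \<zeta>)"
      unfolding mx(3) using mult_left_mono[OF cmp(1)[OF mx(4-6)], of "D powr (1 + \<alpha>)"] by (simp add: mult_ac)
    then have "(1 + l) * m \<le> K * (D powr (1 + \<alpha>) * N powr \<zeta>)"
      using mult_left_mono[of m _ "1 + l"] l1 by (simp add: K_def mult_ac)
    ultimately show ?thesis using mx by linarith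
  qed
  show ?thesis
  proof (rule that[OF K(2)])
    fix r s t D :: real
    assume rst: "r > 0" "s > 0" "t > 0" and D: "D = max \<bar>r - s\<bar> (t powr (1 / \<alpha>))"
    define den where "den = \<bar>r - s\<bar> powr (1 + \<alpha>) * (r + s) powr (2 * \<zeta>)
        + (t powr (1 / \<alpha>)) powr (1 + \<alpha>) * (t powr (1 / \<alpha>) + r + s) powr (2 * \<zeta>)"
    have Q: "Q_bound \<zeta> \<alpha> t r s = t / den"
      by (simp add: Q_bound_def den_def powr_powr)
    have Dpos: "D > 0" using D rst by (simp add: less_max_iff_disj)
    define G where "G = D powr (1 + \<alpha>) * (r * s + D\<^sup>2) powr \<zeta>"
    have "r * s + D\<^sup>2 > 0" using rst by (simp add: add_pos_nonneg)
    then have G: "G > 0" using Dpos by (simp add: G_def)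
    have b: "(1/k) * G \<le> den" "den \<le> K * G"
      using main[OF rst(1,2) _ D refl den_def] rst by (auto simp: G_def)
    have dpos: "den > 0" using b(1) G k1 by (smt (verit) divide_pos_pos mult_pos_pos)
    have E: "t * D powr (-\<alpha>) * (D powr (-1) * (r * s + D\<^sup>2) powr (- \<zeta>)) = t / G"
      using Dpos by (simp add: G_def powr_minus powr_add inverse_eq_divide)
    have "G \<le> k * den" using b(1) k1 by (simp add: field_simps)
    also have "\<dots> \<le> K * den" using K dpos by (intro mult_right_mono) auto
    finally have "G \<le> K * den" .
    then show "Q_bound \<zeta> \<alpha> t r s \<le> K * (t * D powr (-\<alpha>) * (D powr (-1) * (r * s + D\<^sup>2) powr (- \<zeta>))) \<and>
      t * D powr (-\<alpha>) * (D powr (-1) * (r * s + D\<^sup>2) powr (- \<zeta>)) \<le> K * Q_bound \<zeta> \<alpha> t r s"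
      unfolding E Q using b(2) G dpos rst by (auto simp: field_simps)
  qed
qed

section \<open>Test functions for the stable subordinator\<close>

text \<open>The density is extended by zero to the whole line and its transform is stated with the
  Lebesgue integral, so that series and integral can be exchanged later.\<close>

definition stable_laplace :: "real \<Rightarrow> real \<Rightarrow> (real \<Rightarrow> real) \<Rightarrow> bool" where
  "stable_laplace \<alpha> t f \<longleftrightarrow> (\<forall>\<tau>. 0 \<le> f \<tau>) \<and> (\<forall>\<tau>\<le>0. f \<tau> = 0) \<and>
     (\<forall>l\<ge>0. has_bochner_integral lebesgue (\<lambda>\<tau>. exp (- (l * \<tau>)) * f \<tau>) (exp (- (t * l powr (\<alpha> / 2)))))"

text \<open>A nonnegative gauge-integrable function is absolutely integrable, which carries the
  transform over to the Lebesgue integral. The indicator removes the values of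
  \<open>\<sigma> t\<close> at \<open>\<tau> \<le> 0\<close>, about which nothing is
  assumed.\<close>

lemma stable_subordinator_imp_laplace:
  assumes "stable_subordinator_density \<alpha> \<sigma>" "t > 0"
  shows "stable_laplace \<alpha> t (\<lambda>\<tau>. indicator {0<..} \<tau> * \<sigma> t \<tau>)"
  unfolding stable_laplace_def
proof (intro conjI allI impI)
  have nn: "\<And>\<tau>. \<tau> > 0 \<Longrightarrow> \<sigma> t \<tau> \<ge> 0"
    and L: "\<And>l. l \<ge> 0 \<Longrightarrow> ((\<lambda>\<tau>. exp (- \<tau> * l) * \<sigma> t \<tau>) has_integral exp (- t * l powr (\<alpha> / 2))) {0<..}"
    using assms by (auto simp: stable_subordinator_density_def)
  show "0 \<le> indicator {0<..} \<tau> * \<sigma> t \<tau>" for \<tau> using nn[of \<tau>] by (simp add: indicator_def)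
  show "indicator {0<..} \<tau> * \<sigma> t \<tau> = 0" if "\<tau> \<le> 0" for \<tau> using that by simp
  fix l :: real assume l: "l \<ge> 0"
  have S: "set_integrable lebesgue {0<..} (\<lambda>\<tau>. exp (- \<tau> * l) * \<sigma> t \<tau>)"
    using L[OF l] nn by (intro nonnegative_absolutely_integrable_1) (auto simp: integrable_on_def)
  have "(LINT \<tau>:{0<..}|lebesgue. exp (- \<tau> * l) * \<sigma> t \<tau>) = exp (- t * l powr (\<alpha> / 2))"
    using set_lebesgue_integral_eq_integral(2)[OF S] integral_unique[OF L[OF l]] by simp
  then show "has_bochner_integral lebesgue (\<lambda>\<tau>. exp (- (l * \<tau>)) * (indicator {0<..} \<tau> * \<sigma> t \<tau>))
      (exp (- (t * l powr (\<alpha> / 2))))"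
    using S by (simp add: has_bochner_integral_iff set_integrable_def set_lebesgue_integral_def mult_ac)
qed

text \<open>Self-similarity: in the variable \<open>\<tau> / D\<^sup>2\<close> the parameters enter
  through \<open>t * D powr (- \<alpha>)\<close> alone, which makes the later constants uniform in
  \<open>t\<close> and \<open>D\<close>.\<close>

lemma stable_laplace_scaled:
  assumes "stable_laplace \<alpha> t f" "D > 0" "l \<ge> 0"
  shows "has_bochner_integral lebesgue (\<lambda>\<tau>. exp (- (l * (\<tau> / D\<^sup>2))) * f \<tau>)
     (exp (- (t * D powr (- \<alpha>) * l powr (\<alpha> / 2))))"
proof -
  have "(l / D\<^sup>2) powr (\<alpha> / 2) = l powr (\<alpha> / 2) / (D\<^sup>2) powr (\<alpha> / 2)"
    by (rule powr_divide)
  also have "(D\<^sup>2) powr (\<alpha> / 2) = D powr \<alpha>"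
    using assms(2) powr_powr[of D 2 "\<alpha> / 2"] by simp
  finally have eq: "t * (l / D\<^sup>2) powr (\<alpha> / 2) = t * D powr (- \<alpha>) * l powr (\<alpha> / 2)"
    by (simp add: powr_minus field_simps)
  have "l / D\<^sup>2 \<ge> 0" using assms(3) by simp
  then have "has_bochner_integral lebesgue (\<lambda>\<tau>. exp (- ((l / D\<^sup>2) * \<tau>)) * f \<tau>)
      (exp (- (t * (l / D\<^sup>2) powr (\<alpha> / 2))))"
    using assms(1) unfolding stable_laplace_def by blast
  then show ?thesis unfolding eq by simp
qed

lemma stable_laplace_one_minus_exp:
  assumes "stable_laplace \<alpha> t f" "D > 0" "l \<ge> 0"
  shows "has_bochner_integral lebesgue (\<lambda>\<tau>. (1 - exp (- (l * (\<tau> / D\<^sup>2)))) * f \<tau>)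
     (1 - exp (- (t * D powr (- \<alpha>) * l powr (\<alpha> / 2))))"
  \<comment> \<open>The transform at \<open>l = 0\<close> is the total mass 1, since
    \<open>0 powr (\<alpha> / 2) = 0\<close>.\<close>
  using has_bochner_integral_diff[OF stable_laplace_scaled[OF assms(1,2), of 0] stable_laplace_scaled[OF assms]]
  by (simp add: algebra_simps)

lemma stable_laplace_measurable:
  assumes "stable_laplace \<alpha> t f"
  shows "f \<in> borel_measurable lebesgue"
proof -
  have "has_bochner_integral lebesgue (\<lambda>\<tau>. exp (- (0 * \<tau>)) * f \<tau>) (exp (- (t * 0 powr (\<alpha> / 2))))"
    using assms unfolding stable_laplace_def by blast
  then have "integrable lebesgue f" by (simp add: has_bochner_integral_iff)
  then show ?thesis by (rule borel_measurable_integrable)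
qed

lemma one_minus_exp_ge:
  fixes u :: real
  assumes "u \<ge> 0"
  shows "min 1 u \<le> 2 * (1 - exp (- u))"
proof -
  have "exp (- u) \<le> 1 / (1 + u)"
    using exp_ge_add_one_self[of u] assms by (simp add: exp_minus field_simps)
  then have "2 * (1 - 1 / (1 + u)) \<le> 2 * (1 - exp (- u))" by simp
  moreover have "min 1 u \<le> 2 * (1 - 1 / (1 + u))"
  proof (cases "u \<le> 1")
    case True
    then have "u * u \<le> 1 * u" using assms by (intro mult_right_mono) auto
    then show ?thesis using True assms by (simp add: min_def field_simps)
  next
    case False
    then show ?thesis by (simp add: min_def field_simps)
  qed
  ultimately show ?thesis by linarith
qed

lemma one_minus_exp_le: "1 - exp (- u) \<le> (u::real)"
  using exp_ge_add_one_self[of "- u"] by simp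

text \<open>This test function is nonpositive outside of \<open>[a, A]\<close> and at most \<open>1\<close> inside, so its integral, a
  combination of Laplace transforms, bounds the mass of that window from below.\<close>

definition window :: "real \<Rightarrow> real \<Rightarrow> real \<Rightarrow> real" where
  "window a A u = (1 - exp (- u)) - 2 * a * (1 - exp (- (u / a))) - 2 * (1 - exp (- (u / A)))"

lemma window_le:
  assumes "0 < a" "a \<le> 1" "1 \<le> A" "u > 0"
  shows "window a A u \<le> (if a \<le> u \<and> u \<le> A then 1 else 0)"
proof -
  have e: "0 \<le> 1 - exp (- (u / a))" "0 \<le> 1 - exp (- (u / A))" using assms by auto
  have ea: "0 \<le> 2 * a * (1 - exp (- (u / a)))" using e(1) assms by (intro mult_nonneg_nonneg) auto
  have lin: "E - X - 2 * Y \<le> b" if "0 \<le> X" "0 \<le> Y" "E \<le> X + b \<or> E \<le> 2 * Y + b" for E X Y b :: real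
    using that by linarith
  \<comment> \<open>Below \<open>a\<close>, the second term of \<open>window\<close> outweighs
    \<open>1 - exp (- u) \<le> u\<close>; above \<open>A\<close>, the third one is at least 1.
    Between them both subtracted terms are dropped.\<close>
  consider "a \<le> u \<and> u \<le> A" | "u < a" | "u > A" "u \<ge> a" by linarith
  then show ?thesis
  proof cases
    case 1
    have "1 - exp (- u) \<le> 2 * a * (1 - exp (- (u / a))) + 1" using ea exp_gt_zero[of "- u"] by linarith
    then have "window a A u \<le> 1" unfolding window_def using e ea by (intro lin) blast+
    then show ?thesis using 1 by simp
  next
    case 2
    have "u / a \<le> 2 * (1 - exp (- (u / a)))" using one_minus_exp_ge[of "u / a"] 2 assms by simp
    then have "a * (u / a) \<le> a * (2 * (1 - exp (- (u / a))))" using assms by (intro mult_left_mono) auto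
    then have "u \<le> 2 * a * (1 - exp (- (u / a)))" using assms by (simp add: algebra_simps)
    then have "1 - exp (- u) \<le> 2 * a * (1 - exp (- (u / a))) + 0" using one_minus_exp_le[of u] by linarith
    then have "window a A u \<le> 0" unfolding window_def using e ea by (intro lin) blast+
    then show ?thesis using 2 by simp
  next
    case 3
    have "1 \<le> 2 * (1 - exp (- (u / A)))" using one_minus_exp_ge[of "u / A"] 3 assms by simp
    then have "1 - exp (- u) \<le> 2 * (1 - exp (- (u / A))) + 0" using exp_gt_zero[of "- u"] by linarith
    then have "window a A u \<le> 0" unfolding window_def using e ea by (intro lin) blast+
    then show ?thesis using 3 by simp
  qed
qed

lemma window_integral:
  assumes f: "stable_laplace \<alpha> t f" and D: "D > 0" and a: "a > 0" and A: "A > 0"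
  defines "\<epsilon> \<equiv> t * D powr (- \<alpha>)"
  shows "has_bochner_integral lebesgue (\<lambda>\<tau>. window a A (\<tau> / D\<^sup>2) * f \<tau>)
    ((1 - exp (- \<epsilon>)) - 2 * a * (1 - exp (- (\<epsilon> * (1 / a) powr (\<alpha> / 2))))
      - 2 * (1 - exp (- (\<epsilon> * (1 / A) powr (\<alpha> / 2)))))"
proof -
  have H: "has_bochner_integral lebesgue (\<lambda>\<tau>. (1 - exp (- (l * (\<tau> / D\<^sup>2)))) * f \<tau>)
     (1 - exp (- (\<epsilon> * l powr (\<alpha> / 2))))" if "l \<ge> 0" for l
    unfolding \<epsilon>_def by (rule stable_laplace_one_minus_exp[OF f D that])
  have "has_bochner_integral lebesgue
    (\<lambda>\<tau>. (1 - exp (- (1 * (\<tau> / D\<^sup>2)))) * f \<tau> - 2 * a * ((1 - exp (- ((1 / a) * (\<tau> / D\<^sup>2)))) * f \<tau>)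
       - 2 * ((1 - exp (- ((1 / A) * (\<tau> / D\<^sup>2)))) * f \<tau>))
    ((1 - exp (- (\<epsilon> * 1 powr (\<alpha> / 2)))) - 2 * a * (1 - exp (- (\<epsilon> * (1 / a) powr (\<alpha> / 2))))
      - 2 * (1 - exp (- (\<epsilon> * (1 / A) powr (\<alpha> / 2)))))"
    using a A by (intro has_bochner_integral_diff has_bochner_integral_mult_right H) auto
  moreover have "(\<lambda>\<tau>. window a A (\<tau> / D\<^sup>2) * f \<tau>)
    = (\<lambda>\<tau>. (1 - exp (- (1 * (\<tau> / D\<^sup>2)))) * f \<tau> - 2 * a * ((1 - exp (- ((1 / a) * (\<tau> / D\<^sup>2)))) * f \<tau>)
       - 2 * ((1 - exp (- ((1 / A) * (\<tau> / D\<^sup>2)))) * f \<tau>))"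
    by (simp add: window_def fun_eq_iff algebra_simps)
  ultimately show ?thesis by simp
qed

text \<open>With \<open>b = \<alpha> / 2\<close> the main term is at least
  \<open>\<epsilon> / 2\<close>, and the two corrections are at most
  \<open>2 * \<epsilon> * a powr (1 - b)\<close> and \<open>2 * \<epsilon> * A powr (- b)\<close>.
  As \<open>0 < b < 1\<close>, both powers can be made equal to \<open>1/16\<close>, which leaves
  \<open>\<epsilon> / 4\<close>.\<close>

lemma window_mass:
  fixes \<alpha> :: real
  assumes "0 < \<alpha>" "\<alpha> < 2"
  obtains a A where "0 < a" "a \<le> 1" "1 \<le> A"
    "\<And>\<epsilon>. 0 \<le> \<epsilon> \<Longrightarrow> \<epsilon> \<le> 1 \<Longrightarrow>
      \<epsilon> / 4 \<le> (1 - exp (- \<epsilon>)) - 2 * a * (1 - exp (- (\<epsilon> * (1 / a) powr (\<alpha> / 2))))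
      - 2 * (1 - exp (- (\<epsilon> * (1 / A) powr (\<alpha> / 2))))"
proof -
  define b where "b = \<alpha> / 2"
  have b: "0 < b" "b < 1" using assms by (auto simp: b_def)
  define a where "a = (1/16::real) powr (1 / (1 - b))"
  define A where "A = (16::real) powr (1 / b)"
  have a: "0 < a" "a \<le> 1" using b by (auto simp: a_def intro!: powr_le1)
  have A: "1 \<le> A" using b by (auto simp: A_def intro!: ge_one_powr_ge_zero)
  have "a powr (1 - b) = 1/16" using b by (simp add: a_def powr_powr)
  then have aa: "a * (1 / a) powr b = 1/16"
    using a by (simp add: powr_divide powr_diff)
  have "A powr b = 16" using b by (simp add: A_def powr_powr)
  then have AA: "(1 / A) powr b = 1/16" using A by (simp add: powr_divide)
  show ?thesis
  proof (rule that[OF a A], fold b_def)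
    fix \<epsilon> :: real assume e: "0 \<le> \<epsilon>" "\<epsilon> \<le> 1"
    have 1: "\<epsilon> / 2 \<le> 1 - exp (- \<epsilon>)" using one_minus_exp_ge[OF e(1)] e by simp
    have "a * (1 - exp (- (\<epsilon> * (1 / a) powr b))) \<le> a * (\<epsilon> * (1 / a) powr b)"
      using a by (intro mult_left_mono one_minus_exp_le) auto
    also have "\<dots> = \<epsilon> / 16" using aa by (metis mult.left_commute mult.right_neutral times_divide_eq_right)
    finally have 2: "a * (1 - exp (- (\<epsilon> * (1 / a) powr b))) \<le> \<epsilon> / 16" .
    have 3: "1 - exp (- (\<epsilon> * (1 / A) powr b)) \<le> \<epsilon> / 16"
      using one_minus_exp_le[of "\<epsilon> * (1 / A) powr b"] by (simp add: AA)
    have "\<epsilon> / 4 \<le> E - 2 * X - 2 * Y" if "\<epsilon> / 2 \<le> E" "X \<le> \<epsilon> / 16" "Y \<le> \<epsilon> / 16" for E X Y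
      using that by linarith
    from this[OF 1 2 3]
    show "\<epsilon> / 4 \<le> (1 - exp (- \<epsilon>)) - 2 * a * (1 - exp (- (\<epsilon> * (1 / a) powr b)))
      - 2 * (1 - exp (- (\<epsilon> * (1 / A) powr b)))"
      unfolding mult.assoc .
  qed
qed

section \<open>Negative moments of the subordinator\<close>

text \<open>A mixture of exponentials singular enough at 0 to dominate \<open>u powr (- p)\<close>,
  so that a negative moment can be estimated termwise by Laplace transforms.\<close>

definition exp_majorant :: "real \<Rightarrow> real \<Rightarrow> real" where
  "exp_majorant p u = (\<Sum>n. (real n + 1) powr p * exp (- (real n * u)))"

lemma summable_exp_majorant:
  fixes u :: real
  assumes "u > 0"
  shows "summable (\<lambda>n. (real n + 1) powr p * exp (- (real n * u)))"
proof -
  have "(\<lambda>n. (real n + 1) powr p * exp (- (real n * u))) \<in> O(\<lambda>n. real n powr (- 2))"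
    using assms by real_asymp
  then show ?thesis by (rule summable_comparison_test_bigo[rotated]) (simp add: summable_real_powr_iff)
qed

lemma exp_majorant_ge:
  assumes "u > 0" "p \<ge> 0"
  shows "(if u \<ge> 1 then 1 else u powr (- p)) \<le> exp 1 * exp_majorant p u"
proof -
  have ge: "(real n + 1) powr p * exp (- (real n * u)) \<le> exp_majorant p u" for n
  proof -
    have "(\<Sum>i\<in>{n}. (real i + 1) powr p * exp (- (real i * u))) \<le> exp_majorant p u"
      unfolding exp_majorant_def by (rule sum_le_suminf[OF summable_exp_majorant[OF assms(1)]]) auto
    then show ?thesis by simp
  qed
  show ?thesis
  proof (cases "u \<ge> 1")
    case True
    have "1 * 1 \<le> exp 1 * exp_majorant p u"
      using ge[of 0] by (intro mult_mono) auto
    then show ?thesis using True by simp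
  next
    case False
    \<comment> \<open>For the integer part of \<open>1 / u\<close> the power factor already reaches
      \<open>u powr (- p)\<close>, while the exponential is still at least
      \<open>exp (- 1)\<close>.\<close>
    define n where "n = nat \<lfloor>1 / u\<rfloor>"
    have n: "real n \<le> 1 / u" "1 / u \<le> real n + 1"
      using assms by (auto simp: n_def)
    have "u powr (- p) = (1 / u) powr p" using assms by (simp add: powr_minus powr_divide inverse_eq_divide)
    also have "\<dots> \<le> (real n + 1) powr p" using n assms by (intro powr_mono2) auto
    also have "\<dots> = (real n + 1) powr p * (exp 1 * exp (- 1))" by (simp add: exp_minus)
    also have "\<dots> \<le> (real n + 1) powr p * (exp 1 * exp (- (real n * u)))"
      using n(1) assms by (intro mult_left_mono) (auto simp: field_simps)
    also have "\<dots> \<le> exp 1 * exp_majorant p u" using ge[of n] by (simp add: mult_ac)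
    finally show ?thesis using False by simp
  qed
qed

text \<open>When \<open>t * D powr (- \<alpha>) = 1\<close>, the \<open>n\<close>-th exponential
  integrates to \<open>exp (- (n powr (\<alpha> / 2)))\<close>. This stretched exponential beats the
  weight \<open>(n + 1) powr p\<close>, so one convergent series serves all \<open>f\<close>,
  \<open>t\<close> and \<open>D\<close>; nonnegativity permits the exchange of sum and
  integral.\<close>

lemma exp_majorant_integral:
  fixes \<alpha> p :: real
  assumes "0 < \<alpha>" 
  obtains C where "C > 0"
    "\<And>f t D. stable_laplace \<alpha> t f \<Longrightarrow> D > 0 \<Longrightarrow> t * D powr (- \<alpha>) = 1 \<Longrightarrow>
       integrable lebesgue (\<lambda>\<tau>. exp_majorant p (\<tau> / D\<^sup>2) * f \<tau>) \<and>
       (\<integral>\<tau>. exp_majorant p (\<tau> / D\<^sup>2) * f \<tau> \<partial>lebesgue) \<le> C"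
proof -
  define C where "C = (\<Sum>n. (real n + 1) powr p * exp (- (real n powr (\<alpha> / 2))))"
  have b: "\<alpha> / 2 > 0" using assms by simp
  have "(\<lambda>n. (real n + 1) powr p * exp (- (real n powr (\<alpha> / 2)))) \<in> O(\<lambda>n. real n powr (- 2))"
    using b by real_asymp
  then have S: "summable (\<lambda>n. (real n + 1) powr p * exp (- (real n powr (\<alpha> / 2))))"
    by (rule summable_comparison_test_bigo[rotated]) (simp add: summable_real_powr_iff)
  have C0: "C \<ge> 0" unfolding C_def by (rule suminf_nonneg[OF S]) auto
  show ?thesis
  proof (rule that[of "C + 1"])
    fix f t D assume f: "stable_laplace \<alpha> t f" and D: "D > 0" and e: "t * D powr (- \<alpha>) = 1"
    have f0: "f \<tau> \<ge> 0" "\<tau> \<le> 0 \<Longrightarrow> f \<tau> = 0" for \<tau> using f by (auto simp: stable_laplace_def)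
    define g where "g n \<tau> = (real n + 1) powr p * (exp (- (real n * (\<tau> / D\<^sup>2))) * f \<tau>)" for n \<tau>
    have hb: "has_bochner_integral lebesgue (g n) ((real n + 1) powr p * exp (- (real n powr (\<alpha> / 2))))" for n
      unfolding g_def using stable_laplace_scaled[OF f D, of "real n"]
      by (intro has_bochner_integral_mult_right) (auto simp: e)
    then have gi: "integrable lebesgue (g n)"
      and gI: "integral\<^sup>L lebesgue (g n) = (real n + 1) powr p * exp (- (real n powr (\<alpha> / 2)))" for n
      by (auto simp: has_bochner_integral_iff)
    have gn: "norm (g n \<tau>) = g n \<tau>" for n \<tau> by (simp add: g_def f0)
    have gs: "summable (\<lambda>n. g n \<tau>)" and gsum: "(\<Sum>n. g n \<tau>) = exp_majorant p (\<tau> / D\<^sup>2) * f \<tau>" for \<tau>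
    proof -
      have "summable (\<lambda>n. g n \<tau>) \<and> (\<Sum>n. g n \<tau>) = exp_majorant p (\<tau> / D\<^sup>2) * f \<tau>"
      proof (cases "\<tau> > 0")
        case True
        then have s: "summable (\<lambda>n. (real n + 1) powr p * exp (- (real n * (\<tau> / D\<^sup>2))))"
          using D by (intro summable_exp_majorant) auto
        have "(\<lambda>n. g n \<tau>) = (\<lambda>n. (real n + 1) powr p * exp (- (real n * (\<tau> / D\<^sup>2))) * f \<tau>)"
          by (simp add: g_def mult.assoc)
        then show ?thesis using summable_mult2[OF s] suminf_mult2[OF s] by (simp add: exp_majorant_def)
      next
        case False
        then show ?thesis by (simp add: g_def f0)
      qed
      then show "summable (\<lambda>n. g n \<tau>)" "(\<Sum>n. g n \<tau>) = exp_majorant p (\<tau> / D\<^sup>2) * f \<tau>" by auto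
    qed
    have A: "AE \<tau> in lebesgue. summable (\<lambda>n. norm (g n \<tau>))" unfolding gn by (rule AE_I2) (rule gs)
    have B: "summable (\<lambda>n. \<integral>\<tau>. norm (g n \<tau>) \<partial>lebesgue)" unfolding gn gI by (rule S)
    show "integrable lebesgue (\<lambda>\<tau>. exp_majorant p (\<tau> / D\<^sup>2) * f \<tau>) \<and>
       (\<integral>\<tau>. exp_majorant p (\<tau> / D\<^sup>2) * f \<tau> \<partial>lebesgue) \<le> C + 1"
      using integrable_suminf[OF gi A B] integral_suminf[OF gi A B] unfolding gsum gI by (simp add: C_def)
  qed (use C0 in simp)
qed

section \<open>The subordinated kernel\<close>

text \<open>Replaces \<open>\<tau>\<close> by \<open>D\<^sup>2\<close> in the profile. For
  \<open>u \<ge> 1\<close> nothing is lost: if \<open>\<zeta>\<close> is negative, the gain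
  \<open>u powr (- \<zeta>)\<close> of the base is offset by \<open>u powr (-1/2)\<close>. For
  \<open>u < 1\<close> the bases differ by a factor of at most \<open>1 / u\<close>, which costs
  \<open>u powr (- \<bar>\<zeta>\<bar>)\<close>.\<close>

lemma heat_profile_upper:
  fixes r s \<tau> D \<zeta> :: real
  assumes "\<zeta> > -1/2" "r > 0" "s > 0" "\<tau> > 0" "D > 0"
  shows "heat_profile \<zeta> \<tau> r s \<le> D powr (-1) * (r * s + D\<^sup>2) powr (- \<zeta>)
     * (if \<tau> / D\<^sup>2 \<ge> 1 then 1 else (\<tau> / D\<^sup>2) powr (- (1/2 + \<bar>\<zeta>\<bar>))) * exp (- (r - s)\<^sup>2 / (4 * \<tau>))"
proof -
  define u where "u = \<tau> / D\<^sup>2"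
  define N where "N = r * s + D\<^sup>2"
  define M where "M = r * s + \<tau>"
  have u: "u > 0" "\<tau> = D\<^sup>2 * u" using assms by (auto simp: u_def)
  have rs: "r * s > 0" using assms by simp
  have MN: "M > 0" "N > 0" using rs assms by (auto simp: M_def N_def add_pos_nonneg)
  have tau: "\<tau> powr (-1/2) = D powr (-1) * u powr (-1/2)"
  proof -
    have "\<tau> powr (-1/2) = (D\<^sup>2) powr (-1/2) * u powr (-1/2)" unfolding u(2) by (rule powr_mult)
    also have "(D\<^sup>2) powr (-1/2) = D powr (-1)" using assms powr_powr[of D 2 "-1/2"] by simp
    finally show ?thesis .
  qed
  have prof: "heat_profile \<zeta> \<tau> r s = D powr (-1) * (u powr (-1/2) * M powr (- \<zeta>)) * exp (- (r - s)\<^sup>2 / (4 * \<tau>))"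
    unfolding heat_profile_def tau M_def by (simp add: powr_minus field_simps)
  have "u powr (-1/2) * M powr (- \<zeta>) \<le> N powr (- \<zeta>) * (if u \<ge> 1 then 1 else u powr (- (1/2 + \<bar>\<zeta>\<bar>)))"
  proof (cases "u \<ge> 1")
    case True
    have D2: "D\<^sup>2 \<le> D\<^sup>2 * u" using True by (simp add: mult_le_cancel_left1)
    have NM: "N \<le> M" unfolding M_def N_def u(2) using D2 by simp
    show ?thesis
    proof (cases "\<zeta> \<ge> 0")
      case z: True
      have "u powr (-1/2) \<le> 1" using True powr_mono[of "-1/2" 0 u] by simp
      moreover have "M powr (- \<zeta>) \<le> N powr (- \<zeta>)" using z NM MN by (intro powr_mono2') auto
      ultimately have "u powr (-1/2) * M powr (- \<zeta>) \<le> 1 * N powr (- \<zeta>)" by (intro mult_mono) auto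
      then show ?thesis using True by simp
    next
      case z: False
      have "r * s \<le> u * (r * s)" using True rs by (simp add: mult_le_cancel_right1)
      then have "M \<le> u * N" unfolding M_def N_def u(2) by (simp add: algebra_simps)
      then have "M powr (- \<zeta>) \<le> (u * N) powr (- \<zeta>)" using z MN by (intro powr_mono2) auto
      also have "\<dots> = u powr (- \<zeta>) * N powr (- \<zeta>)" by (rule powr_mult)
      finally have "u powr (-1/2) * M powr (- \<zeta>) \<le> u powr (-1/2) * (u powr (- \<zeta>) * N powr (- \<zeta>))"
        by (intro mult_left_mono) auto
      also have "\<dots> = u powr (-1/2 - \<zeta>) * N powr (- \<zeta>)"
        using powr_add[of u "-1/2" "- \<zeta>"] by simp
      also have "\<dots> \<le> 1 * N powr (- \<zeta>)"
        using True assms(1) powr_mono[of "-1/2 - \<zeta>" 0 u] by (intro mult_right_mono) auto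
      finally show ?thesis using True by simp
    qed
  next
    case False
    have D2: "D\<^sup>2 * u \<le> D\<^sup>2" using False assms by (simp add: mult_le_cancel_left2)
    have N1: "N \<le> (1 / u) * M"
    proof -
      have "u * N \<le> M"
      proof -
        have "u * (r * s) \<le> 1 * (r * s)" using False rs by (intro mult_right_mono) auto
        then show ?thesis unfolding M_def N_def u(2) by (simp add: algebra_simps)
      qed
      then show ?thesis using u by (simp add: field_simps)
    qed
    have "M \<le> N" unfolding M_def N_def u(2) using D2 by simp
    also have "N \<le> (1 / u) * N" using False u MN by (simp add: field_simps)
    finally have "M powr (- \<zeta>) \<le> (1 / u) powr \<bar>- \<zeta>\<bar> * N powr (- \<zeta>)"
      using N1 MN u False by (intro powr_le_const_mult_powr) auto
    also have "(1 / u) powr \<bar>- \<zeta>\<bar> = u powr (- \<bar>\<zeta>\<bar>)" by (simp add: powr_divide powr_minus inverse_eq_divide)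
    finally have "u powr (-1/2) * M powr (- \<zeta>) \<le> u powr (-1/2) * (u powr (- \<bar>\<zeta>\<bar>) * N powr (- \<zeta>))"
      by (intro mult_left_mono) auto
    also have "\<dots> = (u powr (-1/2) * u powr (- \<bar>\<zeta>\<bar>)) * N powr (- \<zeta>)" by (simp add: mult_ac)
    also have "u powr (-1/2) * u powr (- \<bar>\<zeta>\<bar>) = u powr (- (1/2 + \<bar>\<zeta>\<bar>))"
      unfolding powr_add[symmetric] by simp
    finally show ?thesis using False by (simp add: mult.commute)
  qed
  then have "D powr (-1) * (u powr (-1/2) * M powr (- \<zeta>)) * exp (- (r - s)\<^sup>2 / (4 * \<tau>))
    \<le> D powr (-1) * (N powr (- \<zeta>) * (if u \<ge> 1 then 1 else u powr (- (1/2 + \<bar>\<zeta>\<bar>)))) * exp (- (r - s)\<^sup>2 / (4 * \<tau>))"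
    by (intro mult_left_mono mult_right_mono) auto
  then show ?thesis unfolding prof u_def[symmetric] N_def[symmetric] by (simp only: mult.assoc)
qed

text \<open>On the window \<open>\<tau>\<close> is comparable to \<open>D\<^sup>2\<close>, so
  \<open>\<bar>r - s\<bar> \<le> D\<close> keeps the Gaussian above
  \<open>exp (- 1 / (4 * a))\<close>, and the powers change by bounded factors.\<close>

lemma heat_profile_lower:
  fixes \<zeta> a A :: real
  assumes "0 < a" "a \<le> 1" "1 \<le> A"
  obtains c where "c > 0"
    "\<And>r s \<tau> D. r > 0 \<Longrightarrow> s > 0 \<Longrightarrow> D > 0 \<Longrightarrow> \<bar>r - s\<bar> \<le> D \<Longrightarrow> a \<le> \<tau> / D\<^sup>2 \<Longrightarrow> \<tau> / D\<^sup>2 \<le> A \<Longrightarrow>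
       c * (D powr (-1) * (r * s + D\<^sup>2) powr (- \<zeta>)) \<le> heat_profile \<zeta> \<tau> r s"
proof -
  define k where "k = max A (1 / a)"
  have k: "k \<ge> 1" "A \<le> k" "1 / a \<le> k" using assms by (auto simp: k_def)
  define c where "c = A powr (-1/2) * exp (- 1 / (4 * a)) / k powr \<bar>\<zeta>\<bar>"
  have c: "c > 0" using assms k by (simp add: c_def)
  have "c * (D powr (-1) * (r * s + D\<^sup>2) powr (- \<zeta>)) \<le> heat_profile \<zeta> \<tau> r s"
    if "r > 0" "s > 0" "D > 0" and d: "\<bar>r - s\<bar> \<le> D" and uu: "a \<le> \<tau> / D\<^sup>2" "\<tau> / D\<^sup>2 \<le> A" for r s \<tau> D
  proof -
    define u where "u = \<tau> / D\<^sup>2"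
    define N where "N = r * s + D\<^sup>2"
    define M where "M = r * s + \<tau>"
    have ua: "a \<le> u" "u \<le> A" using uu by (auto simp: u_def)
    have u: "u > 0" "\<tau> = D\<^sup>2 * u" using that assms ua by (auto simp: u_def)
    have tau0: "\<tau> > 0" using u that by simp
    have rs: "r * s > 0" using that by simp
    have MN: "M > 0" "N > 0" using rs tau0 that by (auto simp: M_def N_def add_pos_nonneg)
    have tau: "\<tau> powr (-1/2) = D powr (-1) * u powr (-1/2)"
    proof -
      have "\<tau> powr (-1/2) = (D\<^sup>2) powr (-1/2) * u powr (-1/2)" unfolding u(2) by (rule powr_mult)
      also have "(D\<^sup>2) powr (-1/2) = D powr (-1)" using that powr_powr[of D 2 "-1/2"] by simp
      finally show ?thesis .
    qed
    have prof: "heat_profile \<zeta> \<tau> r s = D powr (-1) * (u powr (-1/2) * exp (- (r - s)\<^sup>2 / (4 * \<tau>)) * M powr (- \<zeta>))"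
      unfolding heat_profile_def tau M_def by (simp add: powr_minus field_simps)
    have uk: "u \<le> k" "1 \<le> k * u"
    proof -
      show "u \<le> k" using ua k by linarith
      have "1 = (1 / a) * a" using assms by simp
      also have "\<dots> \<le> k * u" using k ua assms by (intro mult_mono) auto
      finally show "1 \<le> k * u" .
    qed
    have rsk: "r * s \<le> k * (r * s)" using k rs by (simp add: mult_le_cancel_right1)
    have "D\<^sup>2 * 1 \<le> D\<^sup>2 * (k * u)" using uk by (intro mult_left_mono) auto
    then have 1: "N \<le> k * M" unfolding M_def N_def u(2) using rsk by (simp add: algebra_simps)
    have "D\<^sup>2 * u \<le> D\<^sup>2 * k" using uk by (intro mult_left_mono) auto
    then have 2: "M \<le> k * N" unfolding M_def N_def u(2) using rsk by (simp add: algebra_simps)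
    have N: "N powr (- \<zeta>) \<le> k powr \<bar>- \<zeta>\<bar> * M powr (- \<zeta>)"
      using 1 2 MN k by (intro powr_le_const_mult_powr) auto
    have up: "A powr (-1/2) \<le> u powr (-1/2)" using u ua by (intro powr_mono2') auto
    have "(r - s)\<^sup>2 \<le> D\<^sup>2" using d that by (metis abs_ge_zero power2_abs power_mono)
    also have "\<dots> \<le> \<tau> / a" unfolding u(2) using assms mult_left_mono[OF ua(1), of "D\<^sup>2"] by (simp add: field_simps)
    finally have "(r - s)\<^sup>2 / (4 * \<tau>) \<le> 1 / (4 * a)" using tau0 assms by (simp add: field_simps)
    then have ex: "exp (- 1 / (4 * a)) \<le> exp (- (r - s)\<^sup>2 / (4 * \<tau>))" by simp
    have "c * (D powr (-1) * N powr (- \<zeta>)) \<le> c * (D powr (-1) * (k powr \<bar>- \<zeta>\<bar> * M powr (- \<zeta>)))"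
      using c N by (intro mult_left_mono) auto
    also have "\<dots> = D powr (-1) * (A powr (-1/2) * exp (- 1 / (4 * a)) * M powr (- \<zeta>))"
      using k by (simp add: c_def)
    also have "\<dots> \<le> heat_profile \<zeta> \<tau> r s"
      unfolding prof using up ex by (intro mult_left_mono mult_right_mono mult_mono) auto
    finally show ?thesis unfolding N_def .
  qed
  then show ?thesis using c that[of c] by blast
qed

text \<open>The target is linear in \<open>u\<close> because \<open>min 1 u\<close> is at most twice
  \<open>1 - exp (- u)\<close>, whose integral against the density is at most
  \<open>\<epsilon>\<close>.\<close>

lemma powr_exp_inverse_le:
  fixes p :: real
  obtains C where "C > 0" "\<And>u. u > 0 \<Longrightarrow> u \<le> 1 \<Longrightarrow> u powr (- p) * exp (- 1 / (4 * u)) \<le> C * u"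
proof -
  have "((\<lambda>u::real. u powr (- p) * exp (- 1 / (4 * u)) / u) \<longlongrightarrow> 0) (at_right 0)" by real_asymp
  then have "eventually (\<lambda>u::real. u powr (- p) * exp (- 1 / (4 * u)) / u < 1) (at_right 0)"
    by (rule order_tendstoD) simp
  then obtain d where d: "d > 0" "\<And>u. 0 < u \<Longrightarrow> u < d \<Longrightarrow> u powr (- p) * exp (- 1 / (4 * u)) / u < 1"
    by (auto simp: eventually_at_right_field)
  define C where "C = 1 + d powr (- \<bar>p\<bar>) / d"
  have C: "C \<ge> 1" using d(1) by (simp add: C_def)
  show ?thesis
  proof (rule that[of C])
    fix u :: real assume u: "u > 0" "u \<le> 1"
    have "u powr (- p) * exp (- 1 / (4 * u)) / u \<le> C"
    proof (cases "u < d")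
      case True
      then show ?thesis using d(2)[OF u(1) True] C by linarith
    next
      case False
      have "u powr (- p) * exp (- 1 / (4 * u)) \<le> u powr (- p) * 1" using u by (intro mult_left_mono) auto
      also have "\<dots> \<le> u powr (- \<bar>p\<bar>)" using u by (simp add: powr_mono')
      also have "\<dots> \<le> d powr (- \<bar>p\<bar>)" using False d by (intro powr_mono2') auto
      finally have "u powr (- p) * exp (- 1 / (4 * u)) / u \<le> d powr (- \<bar>p\<bar>) / d"
        using False d u by (intro frac_le) auto
      then show ?thesis by (simp add: C_def)
    qed
    then show "u powr (- p) * exp (- 1 / (4 * u)) \<le> C * u" using u by (simp add: field_simps)
  qed (use C in simp)
qed

section \<open>Integration of the pointwise bounds\<close>

lemma bessel_heat_measurable:
  "(\<lambda>\<tau>. bessel_heat \<zeta> \<tau> r s) \<in> borel_measurable lebesgue"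
proof -
  have "(\<lambda>\<tau>. bessel_heat \<zeta> \<tau> r s) \<in> borel_measurable borel"
    unfolding bessel_heat_def bessel_I_def by measurable
  then show ?thesis by (intro measurable_completion) simp
qed

text \<open>\<open>sub_bessel_heat\<close> is a gauge integral, whose value is informative only once
  the integrand is known to be integrable; domination by \<open>h\<close> supplies this. The
  minorant \<open>g\<close> may take negative values, as \<open>window\<close> does.\<close>

lemma sub_bessel_heat_bounds:
  assumes f: "stable_laplace \<alpha> t f" and fdef: "f = (\<lambda>\<tau>. indicator {0<..} \<tau> * \<sigma> t \<tau>)"
    and B0: "\<And>\<tau>. \<tau> > 0 \<Longrightarrow> 0 \<le> bessel_heat \<zeta> \<tau> r s"
    and up: "\<And>\<tau>. \<tau> > 0 \<Longrightarrow> bessel_heat \<zeta> \<tau> r s \<le> h \<tau>"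
    and lo: "\<And>\<tau>. \<tau> > 0 \<Longrightarrow> g \<tau> \<le> bessel_heat \<zeta> \<tau> r s"
    and h: "integrable lebesgue (\<lambda>\<tau>. h \<tau> * f \<tau>)" and g: "integrable lebesgue (\<lambda>\<tau>. g \<tau> * f \<tau>)"
  shows "(\<integral>\<tau>. g \<tau> * f \<tau> \<partial>lebesgue) \<le> sub_bessel_heat \<sigma> \<zeta> t r s"
    and "sub_bessel_heat \<sigma> \<zeta> t r s \<le> (\<integral>\<tau>. h \<tau> * f \<tau> \<partial>lebesgue)"
proof -
  have f0: "f \<tau> \<ge> 0" "\<tau> \<le> 0 \<Longrightarrow> f \<tau> = 0" for \<tau> using f by (auto simp: stable_laplace_def)
  have fm: "f \<in> borel_measurable lebesgue" by (rule stable_laplace_measurable[OF f])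
  let ?B = "\<lambda>\<tau>. bessel_heat \<zeta> \<tau> r s * f \<tau>"
  have le: "?B \<tau> \<le> h \<tau> * f \<tau>" "g \<tau> * f \<tau> \<le> ?B \<tau>" "0 \<le> ?B \<tau>" for \<tau>
    using up[of \<tau>] lo[of \<tau>] B0[of \<tau>] f0[of \<tau>] by (cases "\<tau> > 0"; auto intro: mult_right_mono)+
  have B: "integrable lebesgue ?B"
  proof (rule Bochner_Integration.integrable_bound[OF h])
    show "?B \<in> borel_measurable lebesgue" using bessel_heat_measurable fm by (rule borel_measurable_times)
    show "AE \<tau> in lebesgue. norm (?B \<tau>) \<le> norm (h \<tau> * f \<tau>)"
    proof (rule AE_I2)
      fix \<tau> show "norm (?B \<tau>) \<le> norm (h \<tau> * f \<tau>)" using le(1)[of \<tau>] le(3)[of \<tau>] by simp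
    qed
  qed
  have eq: "?B = (\<lambda>\<tau>. indicator {0<..} \<tau> *\<^sub>R (bessel_heat \<zeta> \<tau> r s * \<sigma> t \<tau>))"
    by (auto simp: fdef fun_eq_iff indicator_def)
  have S: "set_integrable lebesgue {0<..} (\<lambda>\<tau>. bessel_heat \<zeta> \<tau> r s * \<sigma> t \<tau>)"
    unfolding set_integrable_def using B eq by simp
  have "sub_bessel_heat \<sigma> \<zeta> t r s = integral\<^sup>L lebesgue ?B"
    unfolding sub_bessel_heat_def set_lebesgue_integral_eq_integral(2)[OF S, symmetric]
      set_lebesgue_integral_def eq ..
  then show "(\<integral>\<tau>. g \<tau> * f \<tau> \<partial>lebesgue) \<le> sub_bessel_heat \<sigma> \<zeta> t r s"
    and "sub_bessel_heat \<sigma> \<zeta> t r s \<le> (\<integral>\<tau>. h \<tau> * f \<tau> \<partial>lebesgue)"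
    using integral_mono[OF g B le(2)] integral_mono[OF B h le(1)] by simp_all
qed

lemma sub_bessel_heat_equiv:
  fixes \<zeta> \<alpha> :: real
  assumes z: "\<zeta> > -1/2" and \<alpha>: "0 < \<alpha>" "\<alpha> < 2"
  obtains k K where "k > 0" "K > 0"
    "\<And>\<sigma> r s t D. stable_subordinator_density \<alpha> \<sigma> \<Longrightarrow> r > 0 \<Longrightarrow> s > 0 \<Longrightarrow> t > 0 \<Longrightarrow>
      D = max \<bar>r - s\<bar> (t powr (1 / \<alpha>)) \<Longrightarrow>
      k * (t * D powr (- \<alpha>) * (D powr (-1) * (r * s + D\<^sup>2) powr (- \<zeta>))) \<le> sub_bessel_heat \<sigma> \<zeta> t r s \<and>
      sub_bessel_heat \<sigma> \<zeta> t r s \<le> K * (t * D powr (- \<alpha>) * (D powr (-1) * (r * s + D\<^sup>2) powr (- \<zeta>)))"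
proof -
  define p where "p = 1/2 + \<bar>\<zeta>\<bar>"
  have p: "p \<ge> 0" by (simp add: p_def)
  obtain c C where cC: "c > 0" "C > 0"
    "\<And>r s t. r > 0 \<Longrightarrow> s > 0 \<Longrightarrow> t > 0 \<Longrightarrow> c * heat_profile \<zeta> t r s \<le> bessel_heat \<zeta> t r s"
    "\<And>r s t. r > 0 \<Longrightarrow> s > 0 \<Longrightarrow> t > 0 \<Longrightarrow> bessel_heat \<zeta> t r s \<le> C * heat_profile \<zeta> t r s"
    by (rule bessel_heat_bounds[OF z], rule that)
  obtain a A where aA: "0 < a" "a \<le> 1" "1 \<le> A"
    "\<And>\<epsilon>. 0 \<le> \<epsilon> \<Longrightarrow> \<epsilon> \<le> 1 \<Longrightarrow>
      \<epsilon> / 4 \<le> (1 - exp (- \<epsilon>)) - 2 * a * (1 - exp (- (\<epsilon> * (1 / a) powr (\<alpha> / 2))))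
      - 2 * (1 - exp (- (\<epsilon> * (1 / A) powr (\<alpha> / 2))))"
    by (rule window_mass[OF \<alpha>], rule that)
  obtain b where b: "b > 0"
    "\<And>r s \<tau> D. r > 0 \<Longrightarrow> s > 0 \<Longrightarrow> D > 0 \<Longrightarrow> \<bar>r - s\<bar> \<le> D \<Longrightarrow> a \<le> \<tau> / D\<^sup>2 \<Longrightarrow> \<tau> / D\<^sup>2 \<le> A \<Longrightarrow>
       b * (D powr (-1) * (r * s + D\<^sup>2) powr (- \<zeta>)) \<le> heat_profile \<zeta> \<tau> r s"
    by (rule heat_profile_lower[OF aA(1-3)], rule that)
  obtain C1 where C1: "C1 > 0"
    "\<And>u. u > 0 \<Longrightarrow> u \<le> 1 \<Longrightarrow> u powr (- p) * exp (- 1 / (4 * u)) \<le> C1 * u"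
    by (rule powr_exp_inverse_le, rule that)
  obtain C2 where C2: "C2 > 0"
    "\<And>f t D. stable_laplace \<alpha> t f \<Longrightarrow> D > 0 \<Longrightarrow> t * D powr (- \<alpha>) = 1 \<Longrightarrow>
       integrable lebesgue (\<lambda>\<tau>. exp_majorant p (\<tau> / D\<^sup>2) * f \<tau>) \<and>
       (\<integral>\<tau>. exp_majorant p (\<tau> / D\<^sup>2) * f \<tau> \<partial>lebesgue) \<le> C2"
    by (rule exp_majorant_integral[OF \<alpha>(1)], rule that)
  define K where "K = C * (2 * (C1 + 1) + exp 1 * C2)"
  show ?thesis
  \<comment> \<open>The 4 comes from \<open>window_mass\<close>; \<open>K\<close> adds the constants
    of the two cases for \<open>D\<close>.\<close>
  proof (rule that[of "c * b / 4" K])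
    fix \<sigma> r s t D
    assume \<sigma>: "stable_subordinator_density \<alpha> \<sigma>" and rst: "r > 0" "s > 0" "t > 0"
      and D: "D = max \<bar>r - s\<bar> (t powr (1 / \<alpha>))"
    define \<epsilon> where "\<epsilon> = t * D powr (- \<alpha>)"
    define F where "F = D powr (-1) * (r * s + D\<^sup>2) powr (- \<zeta>)"
    define f where "f = (\<lambda>\<tau>. indicator {0<..} \<tau> * \<sigma> t \<tau>)"
    have f: "stable_laplace \<alpha> t f"
      unfolding f_def using \<sigma> rst(3) by (rule stable_subordinator_imp_laplace)
    have D0: "D > 0" using rst D by (simp add: less_max_iff_disj)
    have dD: "\<bar>r - s\<bar> \<le> D" using D by simp
    have F0: "F \<ge> 0" by (simp add: F_def)
    have e0: "\<epsilon> \<ge> 0" using rst by (simp add: \<epsilon>_def)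
    have Tt: "(t powr (1 / \<alpha>)) powr \<alpha> = t" using rst \<alpha> by (simp add: powr_powr)
    have e1: "\<epsilon> \<le> 1"
    proof -
      have "t \<le> D powr \<alpha>"
        using powr_mono2[of \<alpha> "t powr (1 / \<alpha>)" D] Tt \<alpha> D by simp
      then show ?thesis using D0 by (simp add: \<epsilon>_def powr_minus field_simps)
    qed
    have B0: "\<And>\<tau>. \<tau> > 0 \<Longrightarrow> 0 \<le> bessel_heat \<zeta> \<tau> r s"
      by (rule bessel_heat_nonneg[OF z rst(1,2)])
    \<comment> \<open>On the window \<open>c * b * F\<close> is a lower bound for the kernel;
      elsewhere \<open>g\<close> is nonpositive and the kernel nonnegative.\<close>
    define g where "g \<tau> = c * b * F * window a A (\<tau> / D\<^sup>2)" for \<tau>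
    have W: "has_bochner_integral lebesgue (\<lambda>\<tau>. window a A (\<tau> / D\<^sup>2) * f \<tau>)
        ((1 - exp (- \<epsilon>)) - 2 * a * (1 - exp (- (\<epsilon> * (1 / a) powr (\<alpha> / 2))))
          - 2 * (1 - exp (- (\<epsilon> * (1 / A) powr (\<alpha> / 2)))))"
      unfolding \<epsilon>_def using aA by (intro window_integral[OF f D0]) auto
    have gi: "integrable lebesgue (\<lambda>\<tau>. g \<tau> * f \<tau>)"
      using W unfolding g_def mult.assoc
      by (intro integrable_mult_right) (simp add: has_bochner_integral_iff)
    have "\<epsilon> / 4 \<le> (\<integral>\<tau>. window a A (\<tau> / D\<^sup>2) * f \<tau> \<partial>lebesgue)"
      using W aA(4)[OF e0 e1] by (simp add: has_bochner_integral_iff)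
    then have "c * b * F * (\<epsilon> / 4) \<le> c * b * F * (\<integral>\<tau>. window a A (\<tau> / D\<^sup>2) * f \<tau> \<partial>lebesgue)"
      using cC b F0 by (intro mult_left_mono) auto
    also have "\<dots> = (\<integral>\<tau>. g \<tau> * f \<tau> \<partial>lebesgue)"
      unfolding g_def mult.assoc by simp
    finally have gI: "c * b * F * (\<epsilon> / 4) \<le> (\<integral>\<tau>. g \<tau> * f \<tau> \<partial>lebesgue)" .
    have lo: "g \<tau> \<le> bessel_heat \<zeta> \<tau> r s" if \<tau>: "\<tau> > 0" for \<tau>
    proof -
      have w: "window a A (\<tau> / D\<^sup>2) \<le> (if a \<le> \<tau> / D\<^sup>2 \<and> \<tau> / D\<^sup>2 \<le> A then 1 else 0)"
        using \<tau> D0 aA by (intro window_le) auto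
      have cbF: "0 \<le> c * b * F" using cC b F0 by simp
      show ?thesis
      proof (cases "a \<le> \<tau> / D\<^sup>2 \<and> \<tau> / D\<^sup>2 \<le> A")
        case True
        then have "window a A (\<tau> / D\<^sup>2) \<le> 1" using w by simp
        then have "g \<tau> \<le> c * b * F * 1" unfolding g_def using cbF by (rule mult_left_mono)
        also have "\<dots> = c * (b * F)" by simp
        also have "\<dots> \<le> c * heat_profile \<zeta> \<tau> r s"
          using b(2)[OF rst(1,2) D0 dD] True cC by (intro mult_left_mono) (auto simp: F_def)
        also have "\<dots> \<le> bessel_heat \<zeta> \<tau> r s" by (rule cC(3)[OF rst(1,2) \<tau>])
        finally show ?thesis .
      next
        case False
        then have "window a A (\<tau> / D\<^sup>2) \<le> 0" using w by (simp only: if_False)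
        then have "g \<tau> \<le> 0" unfolding g_def using cbF by (rule mult_nonneg_nonpos[rotated])
        then show ?thesis using B0[OF \<tau>] by linarith
      qed
    qed
    have prof: "bessel_heat \<zeta> \<tau> r s \<le> C * (F * (if \<tau> / D\<^sup>2 \<ge> 1 then 1 else (\<tau> / D\<^sup>2) powr (- p))
        * exp (- (r - s)\<^sup>2 / (4 * \<tau>)))" if \<tau>: "\<tau> > 0" for \<tau>
    proof -
      have "C * heat_profile \<zeta> \<tau> r s \<le> C * (F * (if \<tau> / D\<^sup>2 \<ge> 1 then 1 else (\<tau> / D\<^sup>2) powr (- p))
        * exp (- (r - s)\<^sup>2 / (4 * \<tau>)))"
        unfolding F_def p_def using cC by (intro mult_left_mono heat_profile_upper[OF z rst(1,2) \<tau> D0]) auto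
      then show ?thesis using cC(4)[OF rst(1,2) \<tau>] by linarith
    qed
    obtain h K' where h: "integrable lebesgue (\<lambda>\<tau>. h \<tau> * f \<tau>)"
      "(\<integral>\<tau>. h \<tau> * f \<tau> \<partial>lebesgue) \<le> C * F * (K' * \<epsilon>)" "K' \<le> 2 * (C1 + 1) + exp 1 * C2"
      "\<And>\<tau>. \<tau> > 0 \<Longrightarrow> bessel_heat \<zeta> \<tau> r s \<le> h \<tau>"
    proof (cases "D = \<bar>r - s\<bar>")
      case True
      have sq: "(r - s)\<^sup>2 = D\<^sup>2" using True by simp
      let ?e = "\<lambda>\<tau>. 1 - exp (- (1 * (\<tau> / D\<^sup>2)))"
      have E: "has_bochner_integral lebesgue (\<lambda>\<tau>. ?e \<tau> * f \<tau>) (1 - exp (- (\<epsilon> * 1 powr (\<alpha> / 2))))"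
        unfolding \<epsilon>_def by (rule stable_laplace_one_minus_exp[OF f D0]) simp
      have EI: "(\<integral>\<tau>. ?e \<tau> * f \<tau> \<partial>lebesgue) \<le> \<epsilon>"
        using E one_minus_exp_le[of \<epsilon>] by (simp add: has_bochner_integral_iff)
      define h where "h \<tau> = C * F * (2 * (C1 + 1)) * ?e \<tau>" for \<tau>
      show ?thesis
      proof (rule that[of h "2 * (C1 + 1)"])
        show "integrable lebesgue (\<lambda>\<tau>. h \<tau> * f \<tau>)"
          using E unfolding h_def mult.assoc[of "C * F * (2 * (C1 + 1))"]
          by (intro integrable_mult_right) (simp add: has_bochner_integral_iff)
        have "(\<integral>\<tau>. h \<tau> * f \<tau> \<partial>lebesgue) = C * F * (2 * (C1 + 1)) * (\<integral>\<tau>. ?e \<tau> * f \<tau> \<partial>lebesgue)"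
          unfolding h_def mult.assoc[of "C * F * (2 * (C1 + 1))"] by (rule integral_mult_right_zero)
        also have "\<dots> \<le> C * F * (2 * (C1 + 1)) * \<epsilon>"
          using EI cC F0 C1 by (intro mult_left_mono) auto
        finally show "(\<integral>\<tau>. h \<tau> * f \<tau> \<partial>lebesgue) \<le> C * F * (2 * (C1 + 1) * \<epsilon>)" by (simp only: mult.assoc)
        show "2 * (C1 + 1) \<le> 2 * (C1 + 1) + exp 1 * C2" using C2 by simp
        fix \<tau> :: real assume \<tau>: "\<tau> > 0"
        define u where "u = \<tau> / D\<^sup>2"
        have u: "u > 0" using \<tau> D0 by (simp add: u_def)
        \<comment> \<open>As \<open>\<bar>r - s\<bar> = D\<close>, the Gaussian is a function of
          \<open>u\<close> alone and tames the negative power.\<close>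
        have x: "- (r - s)\<^sup>2 / (4 * \<tau>) = - 1 / (4 * u)"
          unfolding sq u_def using D0 \<tau> by simp
        have m: "min 1 u \<le> 2 * (1 - exp (- u))" using u by (intro one_minus_exp_ge) simp
        have "(if u \<ge> 1 then 1 else u powr (- p)) * exp (- 1 / (4 * u)) \<le> (C1 + 1) * min 1 u"
        proof (cases "u \<ge> 1")
          case True
          have "exp (- 1 / (4 * u)) \<le> 1" using u by simp
          then have "exp (- 1 / (4 * u)) \<le> C1 + 1" using C1(1) by linarith
          then show ?thesis using True by simp
        next
          case False
          have "u powr (- p) * exp (- 1 / (4 * u)) \<le> C1 * u" using C1(2)[of u] u False by simp
          also have "\<dots> \<le> (C1 + 1) * u" using u by (simp add: algebra_simps)
          finally show ?thesis using False by simp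
        qed
        also have "\<dots> \<le> (C1 + 1) * (2 * (1 - exp (- u)))" using m C1(1) by (intro mult_left_mono) auto
        finally have "C * F * ((if u \<ge> 1 then 1 else u powr (- p)) * exp (- 1 / (4 * u)))
          \<le> C * F * ((C1 + 1) * (2 * (1 - exp (- u))))" using cC F0 by (intro mult_left_mono) auto
        also have "\<dots> = h \<tau>" by (simp add: h_def u_def algebra_simps)
        finally show "bessel_heat \<zeta> \<tau> r s \<le> h \<tau>"
          using prof[OF \<tau>] unfolding x u_def[symmetric] by (simp only: mult.assoc)
      qed
    next
      case False
      then have DT: "D = t powr (1 / \<alpha>)" using D by (simp add: max_def split: if_splits)
      \<comment> \<open>Since \<open>\<epsilon> = 1\<close>, the majorant's integral may be bounded
        by a constant instead of a multiple of \<open>\<epsilon>\<close>; the Gaussian is estimated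
        by 1.\<close>
      have eps: "\<epsilon> = 1" using Tt rst by (simp add: \<epsilon>_def powr_minus DT)
      have M: "integrable lebesgue (\<lambda>\<tau>. exp_majorant p (\<tau> / D\<^sup>2) * f \<tau>)"
        "(\<integral>\<tau>. exp_majorant p (\<tau> / D\<^sup>2) * f \<tau> \<partial>lebesgue) \<le> C2"
        using C2(2)[OF f D0] eps by (auto simp: \<epsilon>_def)
      define h where "h \<tau> = C * F * exp 1 * exp_majorant p (\<tau> / D\<^sup>2)" for \<tau>
      show ?thesis
      proof (rule that[of h "exp 1 * C2"])
        show "integrable lebesgue (\<lambda>\<tau>. h \<tau> * f \<tau>)"
          unfolding h_def mult.assoc[of "C * F * exp 1"] by (intro integrable_mult_right M)
        have "(\<integral>\<tau>. h \<tau> * f \<tau> \<partial>lebesgue) = C * F * exp 1 * (\<integral>\<tau>. exp_majorant p (\<tau> / D\<^sup>2) * f \<tau> \<partial>lebesgue)"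
          unfolding h_def mult.assoc[of "C * F * exp 1"] by (rule integral_mult_right_zero)
        also have "\<dots> \<le> C * F * exp 1 * C2"
          using M(2) cC F0 by (intro mult_left_mono) auto
        finally show "(\<integral>\<tau>. h \<tau> * f \<tau> \<partial>lebesgue) \<le> C * F * (exp 1 * C2 * \<epsilon>)" by (simp add: eps mult.assoc)
        show "exp 1 * C2 \<le> 2 * (C1 + 1) + exp 1 * C2" using C1 by simp
        fix \<tau> :: real assume \<tau>: "\<tau> > 0"
        define u where "u = \<tau> / D\<^sup>2"
        define v where "v = (if u \<ge> 1 then 1 else u powr (- p))"
        have u: "u > 0" using \<tau> D0 by (simp add: u_def)
        have v0: "v \<ge> 0" by (simp add: v_def)
        have "v \<le> exp 1 * exp_majorant p u" unfolding v_def by (rule exp_majorant_ge[OF u p])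
        moreover have "exp (- (r - s)\<^sup>2 / (4 * \<tau>)) \<le> 1" using \<tau> by simp
        ultimately have "v * exp (- (r - s)\<^sup>2 / (4 * \<tau>)) \<le> (exp 1 * exp_majorant p u) * 1"
          using v0 by (intro mult_mono) auto
        then have "C * F * (v * exp (- (r - s)\<^sup>2 / (4 * \<tau>))) \<le> C * F * (exp 1 * exp_majorant p u)"
          using cC F0 by (intro mult_left_mono) auto
        then show "bessel_heat \<zeta> \<tau> r s \<le> h \<tau>"
          using prof[OF \<tau>] unfolding u_def[symmetric] v_def[symmetric] h_def by (simp only: mult.assoc)
      qed
    qed
    note bounds = sub_bessel_heat_bounds[where h = h and g = g and \<sigma> = \<sigma>, OF f f_def B0 h(4) lo h(1) gi]
    have "C * F * (K' * \<epsilon>) \<le> C * F * ((2 * (C1 + 1) + exp 1 * C2) * \<epsilon>)"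
      using h(3) cC F0 e0 by (intro mult_left_mono mult_right_mono) auto
    also have "\<dots> = K * (\<epsilon> * F)" by (simp add: K_def mult_ac)
    finally have "sub_bessel_heat \<sigma> \<zeta> t r s \<le> K * (\<epsilon> * F)" using bounds(2) h(2) by linarith
    moreover have "c * b / 4 * (\<epsilon> * F) \<le> sub_bessel_heat \<sigma> \<zeta> t r s"
      using bounds(1) gI by (simp add: mult_ac)
    ultimately show "c * b / 4 * (t * D powr (- \<alpha>) * (D powr (-1) * (r * s + D\<^sup>2) powr (- \<zeta>)))
        \<le> sub_bessel_heat \<sigma> \<zeta> t r s \<and>
      sub_bessel_heat \<sigma> \<zeta> t r s \<le> K * (t * D powr (- \<alpha>) * (D powr (-1) * (r * s + D\<^sup>2) powr (- \<zeta>)))"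
      unfolding \<epsilon>_def F_def by blast
  qed (use cC b C1 C2 in \<open>auto simp: K_def intro!: mult_pos_pos add_pos_pos\<close>)
qed

theorem theorem2p1:
  fixes \<zeta> :: real
  assumes "\<zeta> > -1/2"
  shows "(\<exists>c1 c2 c3 c4 c5 c6 c7 c8 :: real.
            c1 > 0 \<and> c2 > 0 \<and> c3 > 0 \<and> c4 > 0 \<and> c5 > 0 \<and> c6 > 0 \<and> c7 > 0 \<and> c8 > 0 \<and>
            (\<forall>r s t :: real. r > 0 \<longrightarrow> s > 0 \<longrightarrow> t > 0 \<longrightarrow>
               c1 * t powr (-1/2) * exp (- (r - s)\<^sup>2 / (c2 * t)) / (r * s + t) powr \<zeta>
                 \<le> bessel_heat \<zeta> t r s \<and>
               bessel_heat \<zeta> t r s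
                 \<le> c3 * t powr (-1/2) * exp (- (r - s)\<^sup>2 / (c4 * t)) / (r * s + t) powr \<zeta> \<and>
               c5 * A_zeta \<zeta> t r s * exp (- (r - s)\<^sup>2 / (c6 * t)) \<le> bessel_heat \<zeta> t r s \<and>
               bessel_heat \<zeta> t r s \<le> c7 * A_zeta \<zeta> t r s * exp (- (r - s)\<^sup>2 / (c8 * t))))
       \<and> (\<forall>\<alpha>::real. 0 < \<alpha> \<longrightarrow> \<alpha> < 2 \<longrightarrow>
            (\<exists>K::real. K \<ge> 1 \<and>
               (\<forall>\<sigma>. stable_subordinator_density \<alpha> \<sigma> \<longrightarrow>
                  (\<forall>r s t :: real. r > 0 \<longrightarrow> s > 0 \<longrightarrow> t > 0 \<longrightarrow>
                     Q_bound \<zeta> \<alpha> t r s / K \<le> sub_bessel_heat \<sigma> \<zeta> t r s \<and>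
                     sub_bessel_heat \<sigma> \<zeta> t r s \<le> K * Q_bound \<zeta> \<alpha> t r s))))"
proof (intro conjI allI impI)
  obtain c C where cC: "c > 0" "C > 0"
    "\<And>r s t. r > 0 \<Longrightarrow> s > 0 \<Longrightarrow> t > 0 \<Longrightarrow> c * heat_profile \<zeta> t r s \<le> bessel_heat \<zeta> t r s"
    "\<And>r s t. r > 0 \<Longrightarrow> s > 0 \<Longrightarrow> t > 0 \<Longrightarrow> bessel_heat \<zeta> t r s \<le> C * heat_profile \<zeta> t r s"
    by (rule bessel_heat_bounds[OF assms], rule that)
  obtain K where K: "K > 0"
    "\<And>r s t. r > 0 \<Longrightarrow> s > 0 \<Longrightarrow> t > 0 \<Longrightarrow>
       A_zeta \<zeta> t r s * exp (- (r - s)\<^sup>2 / (8/3 * t)) \<le> K * heat_profile \<zeta> t r s \<and>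
       heat_profile \<zeta> t r s \<le> K * (A_zeta \<zeta> t r s * exp (- (r - s)\<^sup>2 / (8 * t)))"
    by (rule A_zeta_bounds, rule that)
  show "\<exists>c1 c2 c3 c4 c5 c6 c7 c8 :: real.
            c1 > 0 \<and> c2 > 0 \<and> c3 > 0 \<and> c4 > 0 \<and> c5 > 0 \<and> c6 > 0 \<and> c7 > 0 \<and> c8 > 0 \<and>
            (\<forall>r s t :: real. r > 0 \<longrightarrow> s > 0 \<longrightarrow> t > 0 \<longrightarrow>
               c1 * t powr (-1/2) * exp (- (r - s)\<^sup>2 / (c2 * t)) / (r * s + t) powr \<zeta>
                 \<le> bessel_heat \<zeta> t r s \<and>
               bessel_heat \<zeta> t r s
                 \<le> c3 * t powr (-1/2) * exp (- (r - s)\<^sup>2 / (c4 * t)) / (r * s + t) powr \<zeta> \<and>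
               c5 * A_zeta \<zeta> t r s * exp (- (r - s)\<^sup>2 / (c6 * t)) \<le> bessel_heat \<zeta> t r s \<and>
               bessel_heat \<zeta> t r s \<le> c7 * A_zeta \<zeta> t r s * exp (- (r - s)\<^sup>2 / (c8 * t)))"
  proof (rule exI[of _ c], rule exI[of _ 4], rule exI[of _ C], rule exI[of _ 4],
      rule exI[of _ "c / K"], rule exI[of _ "8/3"], rule exI[of _ "C * K"], rule exI[of _ 8],
      intro conjI allI impI)
    fix r s t :: real assume rst: "r > 0" "s > 0" "t > 0"
    show "c * t powr (-1/2) * exp (- (r - s)\<^sup>2 / (4 * t)) / (r * s + t) powr \<zeta> \<le> bessel_heat \<zeta> t r s"
      using cC(3)[OF rst] by (simp add: heat_profile_def mult.assoc)
    show "bessel_heat \<zeta> t r s \<le> C * t powr (-1/2) * exp (- (r - s)\<^sup>2 / (4 * t)) / (r * s + t) powr \<zeta>"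
      using cC(4)[OF rst] by (simp add: heat_profile_def mult.assoc)
    have "c / K * A_zeta \<zeta> t r s * exp (- (r - s)\<^sup>2 / (8/3 * t))
        = c / K * (A_zeta \<zeta> t r s * exp (- (r - s)\<^sup>2 / (8/3 * t)))" by (simp only: mult.assoc)
    also have "\<dots> \<le> c / K * (K * heat_profile \<zeta> t r s)"
      using K cC rst by (intro mult_left_mono) auto
    also have "\<dots> = c * heat_profile \<zeta> t r s" using K by simp
    also have "\<dots> \<le> bessel_heat \<zeta> t r s" by (rule cC(3)[OF rst])
    finally show "c / K * A_zeta \<zeta> t r s * exp (- (r - s)\<^sup>2 / (8/3 * t)) \<le> bessel_heat \<zeta> t r s" .
    have "bessel_heat \<zeta> t r s \<le> C * heat_profile \<zeta> t r s" by (rule cC(4)[OF rst])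
    also have "\<dots> \<le> C * (K * (A_zeta \<zeta> t r s * exp (- (r - s)\<^sup>2 / (8 * t))))"
      using K cC rst by (intro mult_left_mono) auto
    finally show "bessel_heat \<zeta> t r s \<le> C * K * A_zeta \<zeta> t r s * exp (- (r - s)\<^sup>2 / (8 * t))"
      by (simp only: mult.assoc)
  qed (use cC K in auto)
next
  fix \<alpha> :: real assume \<alpha>: "0 < \<alpha>" "\<alpha> < 2"
  obtain k K where kK: "k > 0" "K > 0"
    "\<And>\<sigma> r s t D. stable_subordinator_density \<alpha> \<sigma> \<Longrightarrow> r > 0 \<Longrightarrow> s > 0 \<Longrightarrow> t > 0 \<Longrightarrow>
      D = max \<bar>r - s\<bar> (t powr (1 / \<alpha>)) \<Longrightarrow>
      k * (t * D powr (- \<alpha>) * (D powr (-1) * (r * s + D\<^sup>2) powr (- \<zeta>))) \<le> sub_bessel_heat \<sigma> \<zeta> t r s \<and>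
      sub_bessel_heat \<sigma> \<zeta> t r s \<le> K * (t * D powr (- \<alpha>) * (D powr (-1) * (r * s + D\<^sup>2) powr (- \<zeta>)))"
    by (rule sub_bessel_heat_equiv[OF assms \<alpha>], rule that)
  obtain L where L: "L > 0"
    "\<And>r s t D. r > 0 \<Longrightarrow> s > 0 \<Longrightarrow> t > 0 \<Longrightarrow> D = max \<bar>r - s\<bar> (t powr (1 / \<alpha>)) \<Longrightarrow>
      Q_bound \<zeta> \<alpha> t r s \<le> L * (t * D powr (-\<alpha>) * (D powr (-1) * (r * s + D\<^sup>2) powr (- \<zeta>))) \<and>
      t * D powr (-\<alpha>) * (D powr (-1) * (r * s + D\<^sup>2) powr (- \<zeta>)) \<le> L * Q_bound \<zeta> \<alpha> t r s"
    by (rule Q_bound_equiv[OF assms \<alpha>(1)], rule that)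
  \<comment> \<open>\<open>L / k\<close> serves the lower bound, \<open>K * L\<close> the upper one,
    and the summand 1 ensures \<open>M \<ge> 1\<close>.\<close>
  define M where "M = 1 + L / k + K * L"
  have M: "M \<ge> 1" "L / k \<le> M" "K * L \<le> M" using kK L by (auto simp: M_def)
  show "\<exists>K::real. K \<ge> 1 \<and>
               (\<forall>\<sigma>. stable_subordinator_density \<alpha> \<sigma> \<longrightarrow>
                  (\<forall>r s t :: real. r > 0 \<longrightarrow> s > 0 \<longrightarrow> t > 0 \<longrightarrow>
                     Q_bound \<zeta> \<alpha> t r s / K \<le> sub_bessel_heat \<sigma> \<zeta> t r s \<and>
                     sub_bessel_heat \<sigma> \<zeta> t r s \<le> K * Q_bound \<zeta> \<alpha> t r s))"
  proof (rule exI[of _ M], rule conjI[OF M(1)], intro allI impI)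
    fix \<sigma> and r s t :: real
    assume \<sigma>: "stable_subordinator_density \<alpha> \<sigma>" and rst: "r > 0" "s > 0" "t > 0"
    define D where "D = max \<bar>r - s\<bar> (t powr (1 / \<alpha>))"
    define V where "V = t * D powr (-\<alpha>) * (D powr (-1) * (r * s + D\<^sup>2) powr (- \<zeta>))"
    let ?Q = "Q_bound \<zeta> \<alpha> t r s" and ?S = "sub_bessel_heat \<sigma> \<zeta> t r s"
    have V0: "V \<ge> 0" using rst by (simp add: V_def)
    have Q: "?Q \<le> L * V" "V \<le> L * ?Q" using L(2)[OF rst D_def] by (auto simp: V_def)
    have S: "k * V \<le> ?S" "?S \<le> K * V" using kK(3)[OF \<sigma> rst D_def] by (auto simp: V_def)
    have Q0: "?Q \<ge> 0" using V0 Q(2) L(1) by (smt (verit) mult_pos_neg)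
    have "?Q \<le> (L / k) * (k * V)" using Q(1) kK by simp
    also have "\<dots> \<le> M * ?S" using S(1) M V0 kK by (intro mult_mono) auto
    finally have "?Q / M \<le> ?S" using M(1) by (simp add: divide_le_eq mult.commute)
    moreover have "?S \<le> M * ?Q"
    proof -
      have "?S \<le> K * (L * ?Q)" using order_trans[OF S(2) mult_left_mono[OF Q(2)]] kK by simp
      also have "\<dots> \<le> M * ?Q" using mult_right_mono[OF M(3) Q0] by (simp only: mult.assoc)
      finally show ?thesis .
    qed
    ultimately show "?Q / M \<le> ?S \<and> ?S \<le> M * ?Q" by blast
  qed
qed

end
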